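(* Let $\mathbf c_4\subset S_n$ be the conjugacy class of $4$-cycles and $u_n$ the uniform measure on $S_n$. For $n\ge 11$, $c\ge 2$ and every real $t\ge\frac n2(\log n+c)$, $$d_2\big(h_{\mathbf c_4,t},u_n\big)\le e^{-(c-2)}.$$
   Context: $q_{\mathbf c_4}$ is the uniform probability measure on the set $\mathbf c_4$ of $4$-cycles in $S_n$, $q^{(k)}$ denotes the $k$-fold convolution power, and $h_{\mathbf c_4,t}=e^{-t}\sum_{k\ge0}\frac{t^k}{k!}q_{\mathbf c_4}^{(k)}$. $d_2(p,u)=\big(|G|\sum_{x\in G}|p(x)-u(x)|^2\big)^{1/2}$ with $G=S_n$. *)

theory Defs
  imports "HOL-Analysis.Analysis" "HOL-Combinatorics.Permutations" "HOL-Combinatorics.Cycles"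
begin

definition Sym :: "nat \<Rightarrow> (nat \<Rightarrow> nat) set" where
  "Sym n = {p. p permutes {1..n}}"

definition four_cycles :: "nat \<Rightarrow> (nat \<Rightarrow> nat) set" where
  "four_cycles n = {cycle_of_list [a, b, c, d] | a b c d.
      distinct [a, b, c, d] \<and> set [a, b, c, d] \<subseteq> {1..n}}"

definition q_c4 :: "nat \<Rightarrow> (nat \<Rightarrow> nat) \<Rightarrow> real" where
  "q_c4 n x = (if x \<in> four_cycles n then 1 / real (card (four_cycles n)) else 0)"

definition unif :: "nat \<Rightarrow> (nat \<Rightarrow> nat) \<Rightarrow> real" where
  "unif n x = (if x \<in> Sym n then 1 / real (card (Sym n)) else 0)"

definition conv :: "nat \<Rightarrow> ((nat \<Rightarrow> nat) \<Rightarrow> real) \<Rightarrow> ((nat \<Rightarrow> nat) \<Rightarrow> real)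
    \<Rightarrow> (nat \<Rightarrow> nat) \<Rightarrow> real" where
  "conv n p q x = (\<Sum>y\<in>Sym n. p y * q (inv y \<circ> x))"

primrec conv_pow :: "nat \<Rightarrow> ((nat \<Rightarrow> nat) \<Rightarrow> real) \<Rightarrow> nat \<Rightarrow> (nat \<Rightarrow> nat) \<Rightarrow> real" where
  "conv_pow n p 0 = (\<lambda>x. if x = id then 1 else 0)"
| "conv_pow n p (Suc k) = conv n (conv_pow n p k) p"

definition heat_c4 :: "nat \<Rightarrow> real \<Rightarrow> (nat \<Rightarrow> nat) \<Rightarrow> real" where
  "heat_c4 n t x = exp (- t) * (\<Sum>k. t ^ k / fact k * conv_pow n (q_c4 n) k x)"

definition d2 :: "nat \<Rightarrow> ((nat \<Rightarrow> nat) \<Rightarrow> real) \<Rightarrow> ((nat \<Rightarrow> nat) \<Rightarrow> real) \<Rightarrow> real" where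
  "d2 n p u = sqrt (real (card (Sym n)) * (\<Sum>x\<in>Sym n. \<bar>p x - u x\<bar> ^ 2))"

end

theory Submission
  imports Defs
begin

text \<open>
  By left invariance the squared distance is the sum of \<open>exp (- 2 t (1 - \<theta> / N))\<close> over the
  non-trivial eigenvalues \<open>\<theta>\<close> of the sum of all \<open>N = n (n - 1) (n - 2) (n - 3)\<close> ordered 4-cycles,
  counted with multiplicity. Representation theory is avoided: the role of the partitions with
  first row \<open>k\<close> is played by the functions that have a non-zero average over some subgroup
  \<open>Sym A\<close> with \<open>card A = k\<close> but over none with \<open>card A = k + 1\<close>. Their multiplicity is at most the
  number \<open>(n choose k) * n! / k!\<close> of cosets of such subgroups. For the eigenvalue, let \<open>v\<close> be a
  \<open>Sym A\<close>-invariant eigenvector. As \<open>v\<close> is killed by averaging over \<open>Sym (insert b A)\<close>, every star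
  \<open>\<Sum>a\<in>A. (a b)\<close> acts on \<open>v\<close> as \<open>-1\<close>. Hence the 4-cycle sum of the whole set equals an explicit
  number, plus lower order terms, plus the 4-cycle sum of the complement of \<open>A\<close>: the first row of the
  diagram has been removed. One step suffices if \<open>k\<close> is close to \<open>n\<close>, otherwise one iterates.
\<close>

text \<open>The time \<open>n / 2 * (ln n + c)\<close> comes from the count. For
  \<open>j = n - k\<close>, both factors of the multiplicity bound are at most \<open>n ^ j\<close>,
  and an eigenvalue ratio of at most \<open>1 - 2 * j / n\<close> contributes
  \<open>exp (- 2 * j * (ln n + c))\<close>, which cancels \<open>n ^ (2 * j)\<close> exactly. From
  \<open>j = n / 3\<close> on, a ratio of about \<open>(k / n) ^ 3\<close> is used instead, and the
  binomial coefficients are summed to \<open>2 ^ n\<close> rather than estimated one by one. The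
  obstacle to iterating is that an invariant eigenvector of the whole sum need not be an eigenvector
  of the sum over the complement. Hence the induction bounds a quadratic form on a space cut out by
  averaging conditions, for every subset \<open>B\<close>, and picks a new maximal eigenvector at
  each stage. All functions stay on the whole group; only the acting subgroup shrinks.
  Multiplicities are counted by duality: functions whose averages over all \<open>k\<close>-sets
  vanish are the annihilator of coset indicators, so an orthonormal family perpendicular to them is
  no larger than the set of indicators. This asks for an eigenbasis compatible with the whole
  filtration.\<close>

hide_const (open) Finite_Cartesian_Product.transpose

section \<open>Symmetric operators on functions on a finite set\<close>

definition ip :: "'a set \<Rightarrow> ('a \<Rightarrow> real) \<Rightarrow> ('a \<Rightarrow> real) \<Rightarrow> real" where
  "ip S f g = (\<Sum>x\<in>S. f x * g x)"

text \<open>The support condition makes functions on an infinite type behave like vectors indexed by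
  \<open>S\<close>, so that vanishing on \<open>S\<close> is equality with the zero
  function.\<close>

definition annihilator :: "'a set \<Rightarrow> ('a \<Rightarrow> real) set \<Rightarrow> ('a \<Rightarrow> real) set" where
  "annihilator S G = {f. (\<forall>x. x \<notin> S \<longrightarrow> f x = 0) \<and> (\<forall>g\<in>G. ip S f g = 0)}"

definition orthonormal :: "'a set \<Rightarrow> ('a \<Rightarrow> real) set \<Rightarrow> bool" where
  "orthonormal S E \<longleftrightarrow> (\<forall>e\<in>E. (\<forall>x. x \<notin> S \<longrightarrow> e x = 0) \<and> ip S e e = 1) \<and>
     (\<forall>e\<in>E. \<forall>e'\<in>E. e \<noteq> e' \<longrightarrow> ip S e e' = 0)"

lemma ip_commute: "ip S f g = ip S g f"
  by (simp add: ip_def mult.commute)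

lemma ip_add_left: "ip S (\<lambda>x. f x + g x) h = ip S f h + ip S g h"
  by (simp add: ip_def sum.distrib algebra_simps)

lemma ip_diff_left: "ip S (\<lambda>x. f x - g x) h = ip S f h - ip S g h"
  by (simp add: ip_def sum_subtractf algebra_simps)

lemma ip_scale_left: "ip S (\<lambda>x. a * f x) h = a * ip S f h"
  by (simp add: ip_def sum_distrib_left algebra_simps)

lemma ip_sum_left: "ip S (\<lambda>x. \<Sum>i\<in>I. F i x) h = (\<Sum>i\<in>I. ip S (F i) h)"
  unfolding ip_def by (subst sum.swap) (simp add: sum_distrib_right)

lemma ip_add_right: "ip S h (\<lambda>x. f x + g x) = ip S h f + ip S h g"
  by (metis ip_add_left ip_commute)

lemma ip_diff_right: "ip S h (\<lambda>x. f x - g x) = ip S h f - ip S h g"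
  by (metis ip_diff_left ip_commute)

lemma ip_scale_right: "ip S h (\<lambda>x. a * f x) = a * ip S h f"
  by (metis ip_scale_left ip_commute)

lemma ip_sum_right: "ip S h (\<lambda>x. \<Sum>i\<in>I. F i x) = (\<Sum>i\<in>I. ip S h (F i))"
  by (simp add: ip_commute[of S h] ip_sum_left)

lemmas ip_linear = ip_add_left ip_diff_left ip_scale_left ip_sum_left
  ip_add_right ip_diff_right ip_scale_right ip_sum_right

lemma ip_cong: "(\<And>x. x \<in> S \<Longrightarrow> f x = f' x) \<Longrightarrow> (\<And>x. x \<in> S \<Longrightarrow> g x = g' x) \<Longrightarrow> ip S f g = ip S f' g'"
  by (simp add: ip_def)

lemma ip_self_nonneg: "0 \<le> ip S f f"
  by (simp add: ip_def sum_nonneg)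

lemma ip_self_eq_0:
  assumes "finite S" "ip S f f = 0" "x \<in> S"
  shows "f x = 0"
  using assms by (auto simp: ip_def sum_nonneg_eq_0_iff)

lemma ip_self_pos:
  assumes "finite S" "x \<in> S" "f x \<noteq> 0"
  shows "0 < ip S f f"
proof -
  have "ip S f f \<noteq> 0" using ip_self_eq_0[OF assms(1) _ assms(2)] assms(3) by blast
  then show ?thesis using ip_self_nonneg[of S f] by simp
qed

lemma ip_delta: "finite S \<Longrightarrow> x \<in> S \<Longrightarrow> ip S f (\<lambda>y. if y = x then 1 else 0) = f x"
  by (simp add: ip_def if_distrib cong: if_cong)

lemma annihilator_supp: "f \<in> annihilator S G \<Longrightarrow> x \<notin> S \<Longrightarrow> f x = 0"
  by (simp add: annihilator_def)

lemma annihilator_lincomb: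
  assumes "f \<in> annihilator S G" "g \<in> annihilator S G"
  shows "(\<lambda>x. a * f x + b * g x) \<in> annihilator S G"
  using assms by (simp add: annihilator_def ip_linear)

section \<open>Existence of eigenvectors through the Rayleigh quotient\<close>

lemma quadratic_nonpos_imp_linear_zero:
  fixes a b :: real
  assumes "\<And>s. 2 * s * b + s\<^sup>2 * a \<le> 0"
  shows "b = 0"
proof (rule ccontr)
  assume "b \<noteq> 0"
  \<comment> \<open>This \<open>s\<close> has the sign of \<open>b\<close> and is so small that the
    linear term outweighs the quadratic one.\<close>
  define s where "s = b / (\<bar>a\<bar> + 1)"
  have "2 * s * b + s\<^sup>2 * a = (b\<^sup>2 / (\<bar>a\<bar> + 1)\<^sup>2) * (2 * (\<bar>a\<bar> + 1) + a)"
    by (simp add: s_def divide_simps power2_eq_square) (simp add: algebra_simps)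
  moreover have "\<dots> > 0"
    using \<open>b \<noteq> 0\<close> by (intro mult_pos_pos) auto
  ultimately show False using assms[of s] by simp
qed

text \<open>The eigenvector is a maximiser of the Rayleigh quotient on the unit sphere, which is compact
  in the topology of pointwise convergence.\<close>

lemma max_eigenvector_exists:
  fixes Q :: "('a \<Rightarrow> real) \<Rightarrow> 'a \<Rightarrow> real"
  assumes fin: "finite S"
    and lin: "\<And>a b f g. Q (\<lambda>x. a * f x + b * g x) = (\<lambda>x. a * Q f x + b * Q g x)"
    and cont: "\<And>y. continuous_on UNIV (\<lambda>f. Q f y)"
    and sym: "\<And>f g. ip S (Q f) g = ip S f (Q g)"
    and inv: "\<And>f. f \<in> annihilator S G \<Longrightarrow> Q f \<in> annihilator S G"
    and f0: "f0 \<in> annihilator S G" "x0 \<in> S" "f0 x0 \<noteq> 0"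
  obtains e \<theta> where "e \<in> annihilator S G" "ip S e e = 1" "Q e = (\<lambda>x. \<theta> * e x)"
    "\<And>f. f \<in> annihilator S G \<Longrightarrow> ip S (Q f) f \<le> \<theta> * ip S f f"
proof -
  define K where "K = {f \<in> annihilator S G. ip S f f = 1}"
  have cip: "continuous_on UNIV (\<lambda>f. ip S f g)" for g
    unfolding ip_def by (intro continuous_intros) auto
  have cip2: "continuous_on UNIV (\<lambda>f. ip S f f)"
    unfolding ip_def by (intro continuous_intros) auto
  have cR: "continuous_on UNIV (\<lambda>f. ip S (Q f) f)"
    unfolding ip_def by (intro continuous_intros cont) auto
  have cl: "closed K"
  proof -
    have "K = (\<Inter>x\<in>-S. {f. f x = 0}) \<inter> (\<Inter>g\<in>G. {f. ip S f g = 0}) \<inter> {f. ip S f f = 1}"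
      by (auto simp: K_def annihilator_def)
    moreover have "closed {f :: 'a \<Rightarrow> real. f x = 0}" for x
      by (intro closed_Collect_eq) auto
    moreover have "closed {f :: 'a \<Rightarrow> real. ip S f g = 0}" for g
      by (intro closed_Collect_eq cip) auto
    moreover have "closed {f :: 'a \<Rightarrow> real. ip S f f = 1}"
      by (intro closed_Collect_eq cip2) auto
    ultimately show ?thesis
      by (auto intro!: closed_INT closed_Int)
  qed
  \<comment> \<open>Tychonoff for the cube over the whole type: elements of \<open>K\<close> vanish
    off \<open>S\<close>, so the cube still contains them.\<close>
  have "compactin (product_topology (\<lambda>_. euclidean) UNIV) (PiE UNIV (\<lambda>_::'a. {-1..1::real}))"
    by (subst compactin_PiE) auto
  then have cb: "compact (PiE UNIV (\<lambda>_::'a. {-1..1::real}))"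
    by (metis euclidean_product_topology compactin_euclidean_iff)
  have "K \<subseteq> PiE UNIV (\<lambda>_::'a. {-1..1::real})"
  proof
    fix f assume f: "f \<in> K"
    have "\<bar>f x\<bar> \<le> 1" for x
    proof (cases "x \<in> S")
      case True
      have "f x * f x \<le> ip S f f"
        unfolding ip_def using True fin by (intro member_le_sum) auto
      then show ?thesis
        using f abs_square_le_1[of "f x"] by (simp add: K_def power2_eq_square)
    next
      case False
      then show ?thesis using f by (simp add: K_def annihilator_def)
    qed
    then show "f \<in> PiE UNIV (\<lambda>_::'a. {-1..1::real})"
      by (auto simp: abs_le_iff minus_le_iff)
  qed
  then have cK: "compact K"
    using closed_Int_compact[OF cl cb] by (simp add: Int_absorb2)
  have norm: "(\<lambda>x. f x / sqrt (ip S f f)) \<in> K" if "f \<in> annihilator S G" "ip S f f \<noteq> 0" for f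
  proof -
    have "ip S f f > 0" using that ip_self_nonneg[of S f] by simp
    then have "ip S (\<lambda>x. 1 / sqrt (ip S f f) * f x + 0 * f x) (\<lambda>x. 1 / sqrt (ip S f f) * f x + 0 * f x) = 1"
      by (simp only: ip_linear) (simp add: field_simps)
    then show ?thesis
      unfolding K_def using annihilator_lincomb[OF that(1,1), of "1 / sqrt (ip S f f)" 0] by simp
  qed
  have "ip S f0 f0 \<noteq> 0"
    using ip_self_pos[OF fin f0(2), of f0] f0(3) by simp
  then have "K \<noteq> {}" using norm f0(1) by blast
  then obtain e where e: "e \<in> K" "\<And>f. f \<in> K \<Longrightarrow> ip S (Q f) f \<le> ip S (Q e) e"
    using continuous_attains_sup[OF cK] continuous_on_subset[OF cR] by blast
  define \<theta> where "\<theta> = ip S (Q e) e"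
  have eA: "e \<in> annihilator S G" and e1: "ip S e e = 1"
    using e(1) by (auto simp: K_def)
  have lin1: "Q (\<lambda>x. a * f x) = (\<lambda>x. a * Q f x)" for a f
    using lin[of a f 0 f] by simp
  have bound: "ip S (Q f) f \<le> \<theta> * ip S f f" if f: "f \<in> annihilator S G" for f
  proof (cases "ip S f f = 0")
    case True
    then have "ip S (Q f) f = 0"
      unfolding ip_def using ip_self_eq_0[OF fin True] by (intro sum.neutral) auto
    with True show ?thesis by simp
  next
    case False
    define r where "r = sqrt (ip S f f)"
    have r: "r > 0" "r\<^sup>2 = ip S f f"
      using False ip_self_nonneg[of S f] by (auto simp: r_def)
    have "ip S (Q (\<lambda>x. (1/r) * f x)) (\<lambda>x. (1/r) * f x) \<le> \<theta>"
      using e(2)[OF norm[OF f False]] by (simp add: r_def \<theta>_def)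
    then have "ip S (Q f) f / r\<^sup>2 \<le> \<theta>"
      unfolding lin1 by (simp only: ip_linear) (simp add: power2_eq_square)
    then have "ip S (Q f) f \<le> \<theta> * r\<^sup>2" using r(1) by (simp add: pos_divide_le_eq)
    then show ?thesis using r(2) by simp
  qed
  \<comment> \<open>First-order condition at the maximiser: the Rayleigh inequality for
    \<open>e + s * g\<close>, read as a quadratic polynomial in \<open>s\<close>.\<close>
  have orth: "ip S (\<lambda>x. Q e x - \<theta> * e x) g = 0" if g: "g \<in> annihilator S G" for g
  proof (rule quadratic_nonpos_imp_linear_zero[of _ "ip S (Q g) g - \<theta> * ip S g g"])
    fix s :: real
    have "ip S (Q (\<lambda>x. 1 * e x + s * g x)) (\<lambda>x. 1 * e x + s * g x)
        \<le> \<theta> * ip S (\<lambda>x. 1 * e x + s * g x) (\<lambda>x. 1 * e x + s * g x)"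
      by (intro bound annihilator_lincomb eA g)
    then have "\<theta> + s * ip S (Q e) g + s * (ip S (Q g) e + s * ip S (Q g) g)
        \<le> \<theta> * (1 + s * ip S e g + s * (ip S g e + s * ip S g g))"
      unfolding lin by (simp only: ip_linear) (simp add: e1 \<theta>_def algebra_simps)
    moreover have "ip S (Q g) e = ip S (Q e) g"
      using sym[of g e] by (simp add: ip_commute)
    ultimately show "2 * s * ip S (\<lambda>x. Q e x - \<theta> * e x) g + s\<^sup>2 * (ip S (Q g) g - \<theta> * ip S g g) \<le> 0"
      by (simp add: ip_linear ip_commute[of S g e] algebra_simps power2_eq_square)
  qed
  \<comment> \<open>The residual lies in the invariant subspace, so it can be tested against
    itself.\<close>
  have QA: "(\<lambda>x. Q e x - \<theta> * e x) \<in> annihilator S G"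
    using annihilator_lincomb[OF inv[OF eA] eA, of 1 "- \<theta>"] by simp
  have "Q e x - \<theta> * e x = 0" for x
    using ip_self_eq_0[OF fin orth[OF QA]] annihilator_supp[OF QA] by blast
  then have "Q e = (\<lambda>x. \<theta> * e x)" by (auto simp: fun_eq_iff)
  with eA e1 bound that show thesis by blast
qed

section \<open>Orthonormal systems: Bessel, Gram-Schmidt, dimension counts, Parseval\<close>

lemma bessel:
  assumes "finite E" "orthonormal S E"
  shows "(\<Sum>e\<in>E. (ip S f e)\<^sup>2) \<le> ip S f f"
proof -
  define p where "p = (\<lambda>x. \<Sum>e\<in>E. ip S f e * e x)"
  have pe: "ip S p e = ip S f e" if "e \<in> E" for e
  proof -
    have "ip S p e = (\<Sum>d\<in>E. ip S f d * ip S d e)"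
      by (simp add: p_def ip_linear)
    also have "\<dots> = (\<Sum>d\<in>E. if d = e then ip S f e else 0)"
      using assms(2) that by (intro sum.cong) (auto simp: orthonormal_def)
    finally show ?thesis using assms(1) that by simp
  qed
  have fp: "ip S f p = (\<Sum>e\<in>E. (ip S f e)\<^sup>2)"
    by (simp add: p_def ip_linear power2_eq_square)
  have "ip S p p = ip S p (\<lambda>x. \<Sum>e\<in>E. ip S f e * e x)"
    by (simp only: p_def)
  then have "ip S p p = (\<Sum>e\<in>E. ip S f e * ip S p e)"
    by (simp only: ip_linear)
  then have pp: "ip S p p = (\<Sum>e\<in>E. (ip S f e)\<^sup>2)"
    by (simp add: pe power2_eq_square)
  have "0 \<le> ip S (\<lambda>x. f x - p x) (\<lambda>x. f x - p x)" by (rule ip_self_nonneg)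
  then show ?thesis using fp pp by (simp add: ip_linear ip_commute[of S p f])
qed

lemma orthonormal_expansion_orth:
  assumes "finite E" "orthonormal S E" "e \<in> E"
  shows "ip S (\<lambda>x. f x - (\<Sum>d\<in>E. ip S f d * d x)) e = 0"
proof -
  have "ip S (\<lambda>x. \<Sum>d\<in>E. ip S f d * d x) e = (\<Sum>d\<in>E. if d = e then ip S f e else 0)"
    unfolding ip_sum_left using assms(2,3) by (intro sum.cong) (auto simp: orthonormal_def ip_linear)
  also have "\<dots> = ip S f e" using assms by simp
  finally show ?thesis by (simp add: ip_diff_left)
qed

lemma orthonormal_insert:
  assumes "orthonormal S E" "\<And>x. x \<notin> S \<Longrightarrow> e x = 0" "ip S e e = 1" "\<And>d. d \<in> E \<Longrightarrow> ip S e d = 0"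
  shows "orthonormal S (insert e E)"
  using assms by (auto simp: orthonormal_def ip_commute)

text \<open>Double counting of \<open>(e x)\<^sup>2\<close>: the sum over \<open>x\<close> is 1, and
  the sum over \<open>e\<close> is at most 1 by Bessel for the point mass at
  \<open>x\<close>.\<close>

lemma orthonormal_card_le:
  assumes "finite S" "finite E" "orthonormal S E"
  shows "card E \<le> card S"
proof -
  have "real (card E) = (\<Sum>e\<in>E. \<Sum>x\<in>S. (e x)\<^sup>2)"
    using assms(3) by (simp add: orthonormal_def ip_def power2_eq_square)
  also have "\<dots> = (\<Sum>x\<in>S. \<Sum>e\<in>E. (e x)\<^sup>2)" by (rule sum.swap)
  also have "\<dots> \<le> (\<Sum>x\<in>S. 1)"
  proof (rule sum_mono)
    fix x assume x: "x \<in> S"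
    have "(\<Sum>e\<in>E. (ip S (\<lambda>y. if y = x then 1 else 0) e)\<^sup>2) \<le> 1"
      using bessel[OF assms(2,3), of "\<lambda>y. if y = x then 1 else 0"] ip_delta[OF assms(1) x] by simp
    then show "(\<Sum>e\<in>E. (e x)\<^sup>2) \<le> 1"
      using ip_delta[OF assms(1) x] by (simp add: ip_commute)
  qed
  finally show ?thesis by simp
qed

text \<open>Equality of spans is expressed by equality of the orthogonality conditions, the form in
  which it is used. A vector with zero remainder adds nothing to \<open>E\<close>, which is why the
  cardinality can only drop.\<close>

lemma gram_schmidt:
  assumes "finite S" "finite G"
  shows "\<exists>E. finite E \<and> orthonormal S E \<and> card E \<le> card G \<and>
    (\<forall>f. (\<forall>e\<in>E. ip S f e = 0) \<longleftrightarrow> (\<forall>g\<in>G. ip S f g = 0))"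
  using assms(2)
proof induction
  case empty
  show ?case by (rule exI[of _ "{}"]) (simp add: orthonormal_def)
next
  case (insert g G)
  then obtain E where E: "finite E" "orthonormal S E" "card E \<le> card G"
    "\<And>f. (\<forall>e\<in>E. ip S f e = 0) \<longleftrightarrow> (\<forall>g\<in>G. ip S f g = 0)" by blast
  \<comment> \<open>The remainder is cut off outside \<open>S\<close>, because \<open>g\<close> is
    arbitrary there while \<open>orthonormal\<close> demands support in \<open>S\<close>.\<close>
  define h where "h = (\<lambda>x. if x \<in> S then g x - (\<Sum>d\<in>E. ip S g d * d x) else 0)"
  have hip: "ip S h f = ip S g f - (\<Sum>d\<in>E. ip S g d * ip S d f)" for f
  proof -
    have "ip S h f = ip S (\<lambda>x. g x - (\<Sum>d\<in>E. ip S g d * d x)) f"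
      by (rule ip_cong) (simp_all add: h_def)
    then show ?thesis by (simp add: ip_linear)
  qed
  have hE: "ip S h e = 0" if "e \<in> E" for e
  proof -
    have "ip S h e = ip S (\<lambda>x. g x - (\<Sum>d\<in>E. ip S g d * d x)) e"
      by (rule ip_cong) (simp_all add: h_def)
    then show ?thesis using orthonormal_expansion_orth[OF E(1,2) that, of g] by simp
  qed
  have eq: "ip S f g = ip S f h" if "\<forall>e\<in>E. ip S f e = 0" for f
    using that hip[of f] by (simp add: ip_commute)
  show ?case
  proof (cases "ip S h h = 0")
    case True
    then have "ip S f h = 0" for f
      unfolding ip_def using ip_self_eq_0[OF assms(1) True] by (intro sum.neutral) auto
    then show ?thesis
      using E eq insert.hyps by (intro exI[of _ E]) (auto intro: le_trans)
  next
    case False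
    then have pos: "ip S h h > 0" using ip_self_nonneg[of S h] by simp
    define e where "e = (\<lambda>x. (1 / sqrt (ip S h h)) * h x)"
    have "ip S e e = 1" using pos
      by (simp only: e_def ip_linear) (simp add: field_simps)
    moreover have "ip S e d = 0" if "d \<in> E" for d
      unfolding e_def ip_scale_left using hE[OF that] by simp
    ultimately have on: "orthonormal S (insert e E)"
      by (intro orthonormal_insert E) (auto simp: e_def h_def)
    have fe: "ip S f e = 0 \<longleftrightarrow> ip S f h = 0" for f
      unfolding e_def ip_scale_right using pos by simp
    have "card (insert e E) \<le> card (insert g G)"
      using E(1,3) insert.hyps by (simp add: card_insert_if)
    moreover have "(\<forall>d\<in>insert e E. ip S f d = 0) \<longleftrightarrow> (\<forall>d\<in>insert g G. ip S f d = 0)" for f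
      using E(4)[of f] eq[of f] fe[of f] by (auto simp: ip_commute)
    ultimately show ?thesis using on E(1) by (intro exI[of _ "insert e E"]) simp
  qed
qed

text \<open>Being perpendicular to the annihilator of \<open>G\<close> means lying in the span of
  \<open>G\<close>. The component of \<open>e\<close> orthogonal to the Gram-Schmidt basis
  \<open>D\<close> is in the annihilator, so Bessel is an equality for \<open>e\<close> and
  \<open>D\<close>; exchanging the sums and applying Bessel to \<open>E\<close> compares the
  cardinalities.\<close>

lemma orthonormal_perp_card_le:
  assumes "finite S" "finite G" "finite E" "orthonormal S E"
    and perp: "\<And>e f. e \<in> E \<Longrightarrow> f \<in> annihilator S G \<Longrightarrow> ip S e f = 0"
  shows "card E \<le> card G"
proof -
  obtain D where D: "finite D" "orthonormal S D" "card D \<le> card G"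
    "\<And>f. (\<forall>e\<in>D. ip S f e = 0) \<longleftrightarrow> (\<forall>g\<in>G. ip S f g = 0)"
    using gram_schmidt[OF assms(1,2)] by blast
  have "(\<Sum>d\<in>D. (ip S e d)\<^sup>2) = 1" if e: "e \<in> E" for e
  proof -
    define f where "f = (\<lambda>x. e x - (\<Sum>d\<in>D. ip S e d * d x))"
    have supp: "d x = 0" if "d \<in> insert e D" "x \<notin> S" for d x
      using D(2) assms(4) e that unfolding orthonormal_def by blast
    then have supp': "f x = 0" if "x \<notin> S" for x
      unfolding f_def using supp[OF _ that] by (simp add: sum.neutral)
    have "f \<in> annihilator S G"
      using D(4)[of f] orthonormal_expansion_orth[OF D(1,2), of _ e] supp'
      by (simp add: annihilator_def) (simp add: f_def)
    then have "ip S e f = 0" by (rule perp[OF e])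
    moreover have "ip S e e = 1" using assms(4) e by (simp add: orthonormal_def)
    ultimately show ?thesis by (simp add: f_def ip_linear power2_eq_square)
  qed
  then have "real (card E) = (\<Sum>e\<in>E. \<Sum>d\<in>D. (ip S e d)\<^sup>2)" by simp
  also have "\<dots> = (\<Sum>d\<in>D. \<Sum>e\<in>E. (ip S d e)\<^sup>2)"
    by (subst sum.swap) (simp add: ip_commute)
  also have "\<dots> \<le> (\<Sum>d\<in>D. 1)"
    using D(2) by (intro sum_mono order_trans[OF bessel[OF assms(3,4)]]) (simp add: orthonormal_def)
  finally show ?thesis using D(3) by simp
qed

text \<open>An extension of maximal cardinality is complete: by symmetry of \<open>Q\<close> the
  vectors orthogonal to \<open>E\<close> form an invariant subspace, and if it were non-zero it
  would contain a further eigenvector. Starting from a given \<open>E0\<close> is what later makes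
  one basis fit a chain of subspaces.\<close>

lemma orthonormal_eigenbasis_extend:
  fixes Q :: "('a \<Rightarrow> real) \<Rightarrow> 'a \<Rightarrow> real"
  assumes fin: "finite S"
    and lin: "\<And>a b f g. Q (\<lambda>x. a * f x + b * g x) = (\<lambda>x. a * Q f x + b * Q g x)"
    and cont: "\<And>y. continuous_on UNIV (\<lambda>f. Q f y)"
    and sym: "\<And>f g. ip S (Q f) g = ip S f (Q g)"
    and inv: "\<And>f. f \<in> annihilator S G \<Longrightarrow> Q f \<in> annihilator S G"
    and E0: "finite E0" "orthonormal S E0" "E0 \<subseteq> annihilator S G" "\<And>e. e \<in> E0 \<Longrightarrow> \<exists>\<theta>. Q e = (\<lambda>x. \<theta> * e x)"
  obtains E where "finite E" "E0 \<subseteq> E" "orthonormal S E" "E \<subseteq> annihilator S G"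
    "\<And>e. e \<in> E \<Longrightarrow> \<exists>\<theta>. Q e = (\<lambda>x. \<theta> * e x)"
    "\<And>f. f \<in> annihilator S G \<Longrightarrow> (\<forall>e\<in>E. ip S f e = 0) \<Longrightarrow> f = (\<lambda>_. 0)"
proof -
  define P where "P E \<longleftrightarrow> finite E \<and> E0 \<subseteq> E \<and> orthonormal S E \<and> E \<subseteq> annihilator S G \<and>
    (\<forall>e\<in>E. \<exists>\<theta>. Q e = (\<lambda>x. \<theta> * e x))" for E
  have "P E0" using E0 by (simp add: P_def)
  moreover have "\<forall>E. P E \<longrightarrow> card E < Suc (card S)"
    using orthonormal_card_le[OF fin] by (simp add: P_def less_Suc_eq_le)
  ultimately obtain E where E: "P E" "\<And>E'. P E' \<Longrightarrow> card E' \<le> card E"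
    using Lattices_Big.ex_has_greatest_nat[of P E0 card "Suc (card S)"] by fast
  have "f = (\<lambda>_. 0)" if f: "f \<in> annihilator S G" "\<forall>e\<in>E. ip S f e = 0" for f
  proof (rule ccontr)
    assume "f \<noteq> (\<lambda>_. 0)"
    then obtain x where x: "f x \<noteq> 0" by auto
    then have xS: "x \<in> S" using annihilator_supp[OF f(1)] by metis
    have un: "annihilator S (G \<union> E) = {f \<in> annihilator S G. \<forall>e\<in>E. ip S f e = 0}"
      by (auto simp: annihilator_def)
    have inv': "Q h \<in> annihilator S (G \<union> E)" if "h \<in> annihilator S (G \<union> E)" for h
    proof -
      have h: "h \<in> annihilator S G" "\<And>e. e \<in> E \<Longrightarrow> ip S h e = 0" using that unfolding un by auto
      have "ip S (Q h) e = 0" if e: "e \<in> E" for e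
      proof -
        obtain \<theta> where "Q e = (\<lambda>x. \<theta> * e x)" using E(1) e by (auto simp: P_def)
        then show ?thesis using h(2)[OF e] sym[of h e] by (simp add: ip_linear)
      qed
      then show ?thesis unfolding un using inv h by blast
    qed
    have fGE: "f \<in> annihilator S (G \<union> E)" using f unfolding un by simp
    obtain e \<theta> where e: "e \<in> annihilator S (G \<union> E)" "ip S e e = 1" "Q e = (\<lambda>x. \<theta> * e x)"
      by (rule max_eigenvector_exists[OF fin lin cont sym inv' fGE xS x])
    have eG: "e \<in> annihilator S G" "\<And>d. d \<in> E \<Longrightarrow> ip S e d = 0" using e(1) unfolding un by auto
    have ne: "e \<notin> E" using eG(2) e(2) by force
    have "P (insert e E)"
      using E(1) e eG annihilator_supp[OF eG(1)] unfolding P_def by (auto intro!: orthonormal_insert)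
    with E(2)[of "insert e E"] ne E(1) show False by (simp add: P_def)
  qed
  then show thesis using that E(1) unfolding P_def by blast
qed

text \<open>Only \<open>f\<close> is expanded; \<open>g\<close> is arbitrary, so that an element of
  a small space can be paired with a basis vector of a larger one.\<close>

lemma complete_orthonormal_parseval:
  assumes "finite E" "orthonormal S E" "f \<in> annihilator S G" "E \<subseteq> annihilator S G"
    and "\<And>f. f \<in> annihilator S G \<Longrightarrow> (\<forall>e\<in>E. ip S f e = 0) \<Longrightarrow> f = (\<lambda>_. 0)"
  shows "ip S f g = (\<Sum>e\<in>E. ip S f e * ip S e g)"
proof -
  have "(\<lambda>x. f x - (\<Sum>e\<in>E. ip S f e * e x)) = (\<lambda>_. 0)"
  proof (rule assms(5))
    show "(\<lambda>x. f x - (\<Sum>e\<in>E. ip S f e * e x)) \<in> annihilator S G"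
      using assms(3,4) by (auto simp: annihilator_def subset_iff ip_linear intro!: sum.neutral)
  qed (use orthonormal_expansion_orth[OF assms(1,2)] in auto)
  then have "f = (\<lambda>x. \<Sum>e\<in>E. ip S f e * e x)" by (simp add: fun_eq_iff)
  then have "ip S f g = ip S (\<lambda>x. \<Sum>e\<in>E. ip S f e * e x) g" by simp
  then show "ip S f g = (\<Sum>e\<in>E. ip S f e * ip S e g)" by (simp add: ip_linear)
qed

section \<open>Sums over 4-cycles\<close>

text \<open>Separate sets for the four positions allow a sum over a union to be split position by
  position. Tuples are ordered, so every 4-cycle is met four times.\<close>

definition tuples4 :: "'a set \<Rightarrow> 'a set \<Rightarrow> 'a set \<Rightarrow> 'a set \<Rightarrow> ('a \<times> 'a \<times> 'a \<times> 'a) set" where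
  "tuples4 X1 X2 X3 X4 = (SIGMA a:X1. SIGMA b:X2 - {a}. SIGMA c:X3 - {a, b}. X4 - {a, b, c})"

fun cyc4 :: "'a \<times> 'a \<times> 'a \<times> 'a \<Rightarrow> 'a \<Rightarrow> 'a" where
  "cyc4 (a, b, c, d) = transpose a b \<circ> transpose b c \<circ> transpose c d"

definition cyc4_sum :: "'a set \<Rightarrow> (('a \<Rightarrow> 'a) \<Rightarrow> real) \<Rightarrow> ('a \<Rightarrow> 'a) \<Rightarrow> real" where
  "cyc4_sum B f x = (\<Sum>z\<in>tuples4 B B B B. f (x \<circ> cyc4 z))"

lemma finite_tuples4:
  "finite X1 \<Longrightarrow> finite X2 \<Longrightarrow> finite X3 \<Longrightarrow> finite X4 \<Longrightarrow> finite (tuples4 X1 X2 X3 X4)"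
  unfolding tuples4_def by (intro finite_SigmaI finite_Diff)

lemma sum_tuples4:
  assumes "finite X1" "finite X2" "finite X3" "finite X4"
  shows "sum F (tuples4 X1 X2 X3 X4) =
    (\<Sum>a\<in>X1. \<Sum>b\<in>X2 - {a}. \<Sum>c\<in>X3 - {a, b}. \<Sum>d\<in>X4 - {a, b, c}. F (a, b, c, d))"
proof -
  have "(\<Sum>z\<in>(SIGMA a:X1. SIGMA b:X2 - {a}. SIGMA c:X3 - {a, b}. X4 - {a, b, c}). F z)
     = (\<Sum>a\<in>X1. \<Sum>z\<in>(SIGMA b:X2 - {a}. SIGMA c:X3 - {a, b}. X4 - {a, b, c}). F (a, z))"
    using assms by (subst sum.Sigma) (auto simp: case_prod_unfold intro!: finite_SigmaI)
  also have "\<dots> = (\<Sum>a\<in>X1. \<Sum>b\<in>X2 - {a}. \<Sum>z\<in>(SIGMA c:X3 - {a, b}. X4 - {a, b, c}). F (a, b, z))"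
    using assms by (intro sum.cong refl, subst sum.Sigma) (auto simp: case_prod_unfold intro!: finite_SigmaI)
  also have "\<dots> = (\<Sum>a\<in>X1. \<Sum>b\<in>X2 - {a}. \<Sum>c\<in>X3 - {a, b}. \<Sum>d\<in>X4 - {a, b, c}. F (a, b, c, d))"
    using assms by (intro sum.cong refl, subst sum.Sigma) (auto simp: case_prod_unfold)
  finally show ?thesis by (simp add: tuples4_def)
qed

lemma cyc4_rotate:
  assumes "(a, b, c, d) \<in> tuples4 X1 X2 X3 X4"
  shows "cyc4 (b, c, d, a) = cyc4 (a, b, c, d)"
  using assms by (auto simp: tuples4_def fun_eq_iff Transposition.transpose_def)

lemma sum_tuples4_rotate:
  "(\<Sum>z\<in>tuples4 X1 X2 X3 X4. f (x \<circ> cyc4 z)) = (\<Sum>z\<in>tuples4 X2 X3 X4 X1. f (x \<circ> cyc4 z))"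
proof (rule sum.reindex_bij_witness[where i = "\<lambda>(b, c, d, a). (a, b, c, d)" and j = "\<lambda>(a, b, c, d). (b, c, d, a)"])
  fix z assume "z \<in> tuples4 X1 X2 X3 X4"
  then show "f (x \<circ> cyc4 (case z of (a, b, c, d) \<Rightarrow> (b, c, d, a))) = f (x \<circ> cyc4 z)"
    by (cases z) (simp del: cyc4.simps add: cyc4_rotate)
qed (auto simp: tuples4_def)

lemma sum_tuples4_split:
  fixes F :: "_ \<Rightarrow> real"
  assumes "finite A" "finite D" "A \<inter> D = {}" "finite X" "finite Y" "finite Z"
  shows "sum F (tuples4 (A \<union> D) X Y Z) = sum F (tuples4 A X Y Z) + sum F (tuples4 D X Y Z)"
    and "sum F (tuples4 X (A \<union> D) Y Z) = sum F (tuples4 X A Y Z) + sum F (tuples4 X D Y Z)"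
    and "sum F (tuples4 X Y (A \<union> D) Z) = sum F (tuples4 X Y A Z) + sum F (tuples4 X Y D Z)"
    and "sum F (tuples4 X Y Z (A \<union> D)) = sum F (tuples4 X Y Z A) + sum F (tuples4 X Y Z D)"
proof -
  show "sum F (tuples4 (A \<union> D) X Y Z) = sum F (tuples4 A X Y Z) + sum F (tuples4 D X Y Z)"
    using assms by (subst sum.union_disjoint[symmetric]) (auto simp: finite_tuples4, auto simp: tuples4_def intro!: arg_cong[of _ _ "sum F"])
  show "sum F (tuples4 X (A \<union> D) Y Z) = sum F (tuples4 X A Y Z) + sum F (tuples4 X D Y Z)"
    using assms by (subst sum.union_disjoint[symmetric]) (auto simp: finite_tuples4, auto simp: tuples4_def intro!: arg_cong[of _ _ "sum F"])
  show "sum F (tuples4 X Y (A \<union> D) Z) = sum F (tuples4 X Y A Z) + sum F (tuples4 X Y D Z)"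
    using assms by (subst sum.union_disjoint[symmetric]) (auto simp: finite_tuples4, auto simp: tuples4_def intro!: arg_cong[of _ _ "sum F"])
  show "sum F (tuples4 X Y Z (A \<union> D)) = sum F (tuples4 X Y Z A) + sum F (tuples4 X Y Z D)"
    using assms by (subst sum.union_disjoint[symmetric]) (auto simp: finite_tuples4, auto simp: tuples4_def intro!: arg_cong[of _ _ "sum F"])
qed

text \<open>The sixteen ways to distribute the four positions over \<open>A\<close> and
  \<open>D\<close> fall into six orbits under rotation of the cycle, of sizes 1, 4, 4, 2, 4,
  1.\<close>

lemma cyc4_sum_union:
  assumes "finite A" "finite D" "A \<inter> D = {}"
  defines "T \<equiv> \<lambda>X1 X2 X3 X4 f x. \<Sum>z\<in>tuples4 X1 X2 X3 X4. f (x \<circ> cyc4 z)"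
  shows "cyc4_sum (A \<union> D) f x = cyc4_sum A f x + 4 * T D A A A f x + 4 * T D D A A f x
    + 2 * T D A D A f x + 4 * T D D D A f x + cyc4_sum D f x"
proof -
  have rot: "T X1 X2 X3 X4 f x = T X2 X3 X4 X1 f x" for X1 X2 X3 X4
    unfolding T_def by (rule sum_tuples4_rotate)
  have "cyc4_sum (A \<union> D) f x = T A A A A f x
     + (T D A A A f x + T A D A A f x + T A A D A f x + T A A A D f x)
     + (T D D A A f x + T D A A D f x + T A A D D f x + T A D D A f x)
     + (T D A D A f x + T A D A D f x)
     + (T D D D A f x + T D D A D f x + T D A D D f x + T A D D D f x) + T D D D D f x"
    unfolding cyc4_sum_def T_def using assms(1-3) by (simp add: sum_tuples4_split)
  then show ?thesis
    using rot[of D A A A] rot[of A A A D] rot[of A A D A]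
      rot[of D D A A] rot[of D A A D] rot[of A A D D]
      rot[of D A D A] rot[of D D D A] rot[of D D A D] rot[of D A D D]
    by (simp add: cyc4_sum_def T_def)
qed

lemma sum_off_diagonal_swap:
  fixes f :: "'a \<Rightarrow> 'a \<Rightarrow> real"
  assumes "finite D"
  shows "(\<Sum>a\<in>D. \<Sum>b\<in>D - {a}. f a b) = (\<Sum>b\<in>D. \<Sum>a\<in>D - {b}. f a b)"
proof -
  have "(\<Sum>a\<in>D. \<Sum>b\<in>D - {a}. f a b) = (\<Sum>a\<in>D. \<Sum>b\<in>{b \<in> D. a \<noteq> b}. f a b)"
    by (intro sum.cong refl) auto
  also have "\<dots> = (\<Sum>b\<in>D. \<Sum>a\<in>{a \<in> D. a \<noteq> b}. f a b)"
    by (rule sum.swap_restrict) (use assms in auto)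
  also have "\<dots> = (\<Sum>b\<in>D. \<Sum>a\<in>D - {b}. f a b)"
    by (intro sum.cong refl) auto
  finally show ?thesis .
qed

lemma transpose_comp_rotate:
  assumes "a \<noteq> b" "b \<noteq> c" "a \<noteq> c"
  shows "transpose a b \<circ> transpose b c = transpose c a \<circ> transpose a b"
  using assms by (auto simp: fun_eq_iff Transposition.transpose_def)

text \<open>If \<open>v\<close> is fixed by the permutations of \<open>A\<close> and killed by averaging over the permutations of
  any \<open>insert b A\<close>, then the star \<open>\<Sum>a\<in>A. (a b)\<close> acts on \<open>v\<close> as \<open>-1\<close>. Consequently the mixed
  4-cycles act through shorter cycles of the complement \<open>D\<close>.\<close>

lemma cyc4_sum_peel:
  fixes v :: "('a \<Rightarrow> 'a) \<Rightarrow> real"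
  assumes fin: "finite A" "finite D" and disj: "A \<inter> D = {}"
    and inv: "\<And>a a' x. a \<in> A \<Longrightarrow> a' \<in> A \<Longrightarrow> v (x \<circ> transpose a a') = v x"
    and star: "\<And>b x. b \<in> D \<Longrightarrow> (\<Sum>a\<in>A. v (x \<circ> transpose b a)) = - v x"
    and k: "card A = k" "k \<ge> 1" and j: "card D = j"
  shows "cyc4_sum (A \<union> D) v x =
     (real k * (real k - 1) * (real k - 2) * (real k - 3) - 4 * real j * (real k - 1) * (real k - 2)
        + 2 * real j * (real j - 1)) * v x
     - (4 * real k - 6) * (\<Sum>b\<in>D. \<Sum>c\<in>D - {b}. v (x \<circ> transpose b c))
     - 4 * (\<Sum>b\<in>D. \<Sum>c\<in>D - {b}. \<Sum>d\<in>D - {b, c}. v (x \<circ> transpose b c \<circ> transpose c d))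
     + cyc4_sum D v x"
proof -
  define T where "T = (\<lambda>X1 X2 X3 X4. \<Sum>z\<in>tuples4 X1 X2 X3 X4. v (x \<circ> cyc4 z))"
  define s2 where "s2 = (\<Sum>b\<in>D. \<Sum>c\<in>D - {b}. v (x \<circ> transpose b c))"
  define s3 where "s3 = (\<Sum>b\<in>D. \<Sum>c\<in>D - {b}. \<Sum>d\<in>D - {b, c}. v (x \<circ> transpose b c \<circ> transpose c d))"
  have T: "T X1 X2 X3 X4 = (\<Sum>a\<in>X1. \<Sum>b\<in>X2 - {a}. \<Sum>c\<in>X3 - {a, b}. \<Sum>d\<in>X4 - {a, b, c}.
      v (x \<circ> transpose a b \<circ> transpose b c \<circ> transpose c d))"
    if "finite X1" "finite X2" "finite X3" "finite X4" for X1 X2 X3 X4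
    unfolding T_def by (subst sum_tuples4[OF that]) (simp add: comp_assoc)
  have c1: "real (card (A - {a})) = real k - 1" if "a \<in> A" for a
    using that k fin by (simp add: card_Diff_singleton of_nat_diff)
  have c2: "real (card (A - {a, b})) = real k - 2" if "a \<in> A" "b \<in> A - {a}" for a b
  proof -
    have "card {a, b} \<le> card A" using that fin by (intro card_mono) auto
    moreover have "card {a, b} = 2" using that by auto
    ultimately show ?thesis using that k fin by (simp add: card_Diff_subset of_nat_diff)
  qed
  have c3: "real (card (A - {a, b, c})) = real k - 3" if "a \<in> A" "b \<in> A - {a}" "c \<in> A - {a, b}" for a b c
  proof -
    have "card {a, b, c} \<le> card A" using that fin by (intro card_mono) auto
    moreover have "card {a, b, c} = 3" using that by auto
    ultimately show ?thesis using that k fin by (simp add: card_Diff_subset of_nat_diff)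
  qed
  have dj: "real (card (D - {b})) = real j - 1" if "b \<in> D" for b
  proof -
    have "card D > 0" using that fin by (auto simp: card_gt_0_iff)
    then show ?thesis using that j fin by (simp add: card_Diff_singleton of_nat_diff)
  qed
  have A: "A - {b} = A" "A - {b, a} = A - {a}" "A - {b, a, c} = A - {a, c}"
    "A - {a, b} = A - {a}" "A - {a, b, c} = A - {a, c}" "A - {a, c, b} = A - {a, c}"
    if "b \<in> D" for a b c
    using that disj by auto
  have D: "D - {a} = D" "D - {b, a} = D - {b}" if "a \<in> A" for a b
    using that disj by auto
  have AAAA: "T A A A A = real k * (real k - 1) * (real k - 2) * (real k - 3) * v x"
  proof -
    have "T A A A A = (\<Sum>a\<in>A. \<Sum>b\<in>A - {a}. \<Sum>c\<in>A - {a, b}. \<Sum>d\<in>A - {a, b, c}. v x)"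
      unfolding T[OF fin(1) fin(1) fin(1) fin(1)] by (intro sum.cong refl) (simp add: inv)
    also have "\<dots> = (\<Sum>a\<in>A. \<Sum>b\<in>A - {a}. \<Sum>c\<in>A - {a, b}. (real k - 3) * v x)"
      by (intro sum.cong refl) (simp only: sum_constant c3)
    also have "\<dots> = (\<Sum>a\<in>A. \<Sum>b\<in>A - {a}. (real k - 2) * ((real k - 3) * v x))"
      by (intro sum.cong refl) (simp only: sum_constant c2)
    also have "\<dots> = (\<Sum>a\<in>A. (real k - 1) * ((real k - 2) * ((real k - 3) * v x)))"
      by (intro sum.cong refl) (simp only: sum_constant c1)
    finally show ?thesis using k by simp
  qed
  have DAAA: "T D A A A = - real j * (real k - 1) * (real k - 2) * v x"
  proof -
    have "T D A A A = (\<Sum>b\<in>D. \<Sum>a\<in>A. \<Sum>c\<in>A - {a}. \<Sum>d\<in>A - {a, c}. v (x \<circ> transpose b a))"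
      unfolding T[OF fin(2) fin(1) fin(1) fin(1)] by (intro sum.cong refl) (auto simp: inv A)
    also have "\<dots> = (\<Sum>b\<in>D. \<Sum>a\<in>A. \<Sum>c\<in>A - {a}. (real k - 2) * v (x \<circ> transpose b a))"
      by (intro sum.cong refl) (simp only: sum_constant c2)
    also have "\<dots> = (\<Sum>b\<in>D. \<Sum>a\<in>A. (real k - 1) * ((real k - 2) * v (x \<circ> transpose b a)))"
      by (intro sum.cong refl) (simp only: sum_constant c1)
    also have "\<dots> = (\<Sum>b\<in>D. (real k - 1) * ((real k - 2) * (- v x)))"
      by (intro sum.cong refl) (simp add: sum_distrib_left[symmetric] star)
    finally show ?thesis using j by simp
  qed
  \<comment> \<open>The last factor permutes \<open>A\<close> and is absorbed by invariance; there
    remain \<open>k - 1\<close> equal terms and a star centred at \<open>c\<close>.\<close>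
  have DDAA: "T D D A A = - (real k - 1) * s2"
  proof -
    have "T D D A A = (\<Sum>b\<in>D. \<Sum>c\<in>D - {b}. \<Sum>a\<in>A. \<Sum>d\<in>A - {a}. v (x \<circ> transpose b c \<circ> transpose c a))"
      unfolding T[OF fin(2) fin(2) fin(1) fin(1)]
    proof (intro sum.cong refl)
      fix b c assume "b \<in> D" "c \<in> D - {b}"
      then show "A - {b, c} = A" using disj by auto
    next
      fix b c a assume "b \<in> D" "c \<in> D - {b}" "a \<in> A"
      then show "A - {b, c, a} = A - {a}" using disj by auto
    qed (use inv in auto)
    also have "\<dots> = (\<Sum>b\<in>D. \<Sum>c\<in>D - {b}. \<Sum>a\<in>A. (real k - 1) * v (x \<circ> transpose b c \<circ> transpose c a))"
      by (intro sum.cong refl) (simp only: sum_constant c1)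
    also have "\<dots> = (\<Sum>b\<in>D. \<Sum>c\<in>D - {b}. - (real k - 1) * v (x \<circ> transpose b c))"
      by (intro sum.cong refl) (simp add: sum_distrib_left[symmetric] star, simp add: algebra_simps)
    finally show ?thesis by (simp only: sum_distrib_left s2_def)
  qed
  have DADA: "T D A D A = real j * (real j - 1) * v x + s2"
  proof -
    \<comment> \<open>The star centred at \<open>c\<close> is incomplete, since \<open>d = a\<close>
      is excluded; in the missing term the two transpositions of \<open>a\<close> and
      \<open>c\<close> cancel. The product \<open>(b a) (a c)\<close> is rewritten as
      \<open>(c b) (b a)\<close>, so that \<open>a\<close> occurs in the last factor only and the
      later sum over \<open>a\<close> is again a star.\<close>
    have in4: "(\<Sum>d\<in>A - {a}. v (x \<circ> transpose b a \<circ> transpose a c \<circ> transpose c d))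
        = - v (x \<circ> transpose c b \<circ> transpose b a) - v (x \<circ> transpose b a)"
      if "b \<in> D" "a \<in> A" "c \<in> D" "c \<noteq> b" for a b c
    proof -
      have "(\<Sum>d\<in>A. v (x \<circ> transpose b a \<circ> transpose a c \<circ> transpose c d))
        = v (x \<circ> transpose b a \<circ> transpose a c \<circ> transpose c a)
          + (\<Sum>d\<in>A - {a}. v (x \<circ> transpose b a \<circ> transpose a c \<circ> transpose c d))"
        using fin that by (intro sum.remove)
      moreover have "x \<circ> transpose b a \<circ> transpose a c \<circ> transpose c a = x \<circ> transpose b a"
        by (simp add: comp_assoc transpose_commute[of c a])
      moreover have "x \<circ> transpose b a \<circ> transpose a c = x \<circ> transpose c b \<circ> transpose b a"
      proof -
        have "a \<noteq> b" "a \<noteq> c" using that disj by auto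
        then show ?thesis using transpose_comp_rotate[of b a c] that by (simp add: comp_assoc)
      qed
      ultimately show ?thesis using star[OF that(3), of "x \<circ> transpose b a \<circ> transpose a c"] by simp
    qed
    have "T D A D A = (\<Sum>b\<in>D. \<Sum>a\<in>A. \<Sum>c\<in>D - {b}. \<Sum>d\<in>A - {a}.
        v (x \<circ> transpose b a \<circ> transpose a c \<circ> transpose c d))"
      unfolding T[OF fin(2) fin(1) fin(2) fin(1)]
    proof (intro sum.cong refl)
      fix b a assume "b \<in> D" "a \<in> A"
      then show "D - {b, a} = D - {b}" using disj by auto
    next
      fix b a c assume "b \<in> D" "a \<in> A" "c \<in> D - {b}"
      then show "A - {b, a, c} = A - {a}" using disj by auto
    qed (use disj in auto)
    also have "\<dots> = (\<Sum>b\<in>D. \<Sum>a\<in>A. \<Sum>c\<in>D - {b}.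
        - v (x \<circ> transpose c b \<circ> transpose b a) - v (x \<circ> transpose b a))"
      by (intro sum.cong refl in4) auto
    also have "\<dots> = (\<Sum>b\<in>D. \<Sum>c\<in>D - {b}. \<Sum>a\<in>A.
        - v (x \<circ> transpose c b \<circ> transpose b a) - v (x \<circ> transpose b a))"
      by (intro sum.cong refl sum.swap)
    \<comment> \<open>Both summands are now stars centred at \<open>b\<close>, one of them after
      \<open>(c b)\<close>; each star turns a minus into a plus.\<close>
    also have "\<dots> = (\<Sum>b\<in>D. \<Sum>c\<in>D - {b}. v (x \<circ> transpose b c) + v x)"
      by (intro sum.cong refl) (simp add: sum_subtractf sum_negf star transpose_commute)
    also have "\<dots> = s2 + (\<Sum>b\<in>D. (real j - 1) * v x)"
      by (simp only: sum.distrib s2_def sum_constant dj cong: sum.cong)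
    finally show ?thesis using j by simp
  qed
  have DDDA: "T D D D A = - s3"
  proof -
    have "T D D D A = (\<Sum>b\<in>D. \<Sum>c\<in>D - {b}. \<Sum>d\<in>D - {b, c}. \<Sum>a\<in>A.
        v (x \<circ> transpose b c \<circ> transpose c d \<circ> transpose d a))"
      unfolding T[OF fin(2) fin(2) fin(2) fin(1)] using disj by (intro sum.cong refl) auto
    also have "\<dots> = (\<Sum>b\<in>D. \<Sum>c\<in>D - {b}. \<Sum>d\<in>D - {b, c}. - v (x \<circ> transpose b c \<circ> transpose c d))"
      by (intro sum.cong refl star) auto
    finally show ?thesis by (simp add: s3_def sum_negf)
  qed
  have "cyc4_sum A v x = T A A A A" by (simp add: T_def cyc4_sum_def)
  moreover have "cyc4_sum (A \<union> D) v x = cyc4_sum A v x + 4 * T D A A A + 4 * T D D A A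
    + 2 * T D A D A + 4 * T D D D A + cyc4_sum D v x"
    unfolding T_def by (rule cyc4_sum_union[OF fin disj])
  ultimately show ?thesis
    unfolding AAAA DAAA DDAA DADA DDDA s2_def[symmetric] s3_def[symmetric] by (simp add: algebra_simps)
qed

section \<open>Functions on the symmetric group\<close>

definition sym_sum :: "nat set \<Rightarrow> ((nat \<Rightarrow> nat) \<Rightarrow> real) \<Rightarrow> (nat \<Rightarrow> nat) \<Rightarrow> real" where
  "sym_sum A f x = (\<Sum>\<tau>\<in>{\<tau>. \<tau> permutes A}. f (x \<circ> \<tau>))"

text \<open>The isotypic part of the right regular representation belonging to the partitions with first
  row shorter than \<open>k\<close>; for \<open>B\<close> a proper subset, after restriction to \<open>Sym B\<close>.\<close>

definition no_inv :: "nat \<Rightarrow> nat set \<Rightarrow> nat \<Rightarrow> ((nat \<Rightarrow> nat) \<Rightarrow> real) set" where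
  "no_inv n B k = {f. (\<forall>x. x \<notin> Sym n \<longrightarrow> f x = 0) \<and>
     (\<forall>A \<subseteq> B. card A = k \<longrightarrow> (\<forall>x\<in>Sym n. sym_sum A f x = 0))}"

lemma finite_Sym: "finite (Sym n)"
  by (simp add: Sym_def finite_permutations)

lemma card_Sym: "card (Sym n) = fact n"
  by (simp add: Sym_def card_permutations)

lemma comp_in_Sym_iff:
  assumes "s permutes B" "B \<subseteq> {1..n}"
  shows "x \<circ> s \<in> Sym n \<longleftrightarrow> x \<in> Sym n"
proof -
  have s: "s permutes {1..n}" using assms by (rule permutes_subset)
  have "x permutes {1..n}" if "x \<circ> s permutes {1..n}"
    using permutes_compose[OF permutes_inv[OF s] that] permutes_inv_o(1)[OF s] by (simp add: comp_assoc)
  then show ?thesis using permutes_compose[OF s, of x] by (auto simp: Sym_def)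
qed

lemma transpose_permutes: "a \<in> B \<Longrightarrow> b \<in> B \<Longrightarrow> transpose a b permutes B"
  by (rule permutes_swap_id)

lemma ip_translate:
  assumes "s \<in> Sym n"
  shows "ip (Sym n) (\<lambda>x. f (x \<circ> s)) (\<lambda>x. g (x \<circ> s)) = ip (Sym n) f g"
  unfolding ip_def
proof (rule sum.reindex_bij_witness[where i = "\<lambda>x. x \<circ> inv s" and j = "\<lambda>x. x \<circ> s"])
  have s: "s permutes {1..n}" using assms by (simp add: Sym_def)
  fix x assume x: "x \<in> Sym n"
  show "x \<circ> s \<circ> inv s = x" "x \<circ> inv s \<circ> s = x"
    using permutes_inv_o[OF s] by (simp_all add: comp_assoc)
  show "x \<circ> s \<in> Sym n" using x comp_in_Sym_iff[OF s] by simp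
  show "x \<circ> inv s \<in> Sym n" using x comp_in_Sym_iff[OF permutes_inv[OF s]] by simp
qed simp

lemma ip_translate_left:
  assumes "s \<in> Sym n"
  shows "ip (Sym n) (\<lambda>x. f (x \<circ> s)) g = ip (Sym n) f (\<lambda>x. g (x \<circ> inv s))"
proof -
  have "s permutes {1..n}" using assms by (simp add: Sym_def)
  then have "x \<circ> s \<circ> inv s = x" for x :: "nat \<Rightarrow> nat"
    using permutes_inv_o(1)[OF \<open>s permutes {1..n}\<close>] by (simp add: comp_assoc)
  moreover have "x \<circ> inv s \<circ> s = x" for x :: "nat \<Rightarrow> nat"
    using permutes_inv_o(2)[OF \<open>s permutes {1..n}\<close>] by (simp add: comp_assoc)
  ultimately show ?thesis
    using ip_translate[OF assms, of f "\<lambda>x. g (x \<circ> inv s)"] by simp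
qed

lemma abs_ip_translate_le:
  assumes "s \<in> Sym n"
  shows "\<bar>ip (Sym n) (\<lambda>x. f (x \<circ> s)) f\<bar> \<le> ip (Sym n) f f"
proof -
  let ?g = "\<lambda>x. f (x \<circ> s)"
  have "ip (Sym n) ?g ?g = ip (Sym n) f f" by (rule ip_translate[OF assms])
  moreover have "0 \<le> ip (Sym n) (\<lambda>x. ?g x - f x) (\<lambda>x. ?g x - f x)"
    "0 \<le> ip (Sym n) (\<lambda>x. ?g x + f x) (\<lambda>x. ?g x + f x)"
    by (rule ip_self_nonneg)+
  ultimately show ?thesis
    by (simp add: ip_linear ip_commute[of _ f ?g])
qed

section \<open>The 4-cycle sum as a symmetric operator\<close>

lemma cyc4_permutes:
  assumes "z \<in> tuples4 B B B B"
  shows "cyc4 z permutes B"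
  using assms by (cases z) (auto simp: tuples4_def intro!: permutes_compose transpose_permutes)

lemma cyc4_sum_linear:
  "cyc4_sum B (\<lambda>x. a * f x + b * g x) = (\<lambda>x. a * cyc4_sum B f x + b * cyc4_sum B g x)"
  by (simp add: cyc4_sum_def fun_eq_iff sum.distrib sum_distrib_left)

lemma cyc4_sum_continuous: "continuous_on UNIV (\<lambda>f. cyc4_sum B f y)"
  unfolding cyc4_sum_def by (intro continuous_intros) auto

lemma cyc4_reverse: "inv (cyc4 (a, b, c, d)) = cyc4 (d, c, b, a)"
proof (rule inv_unique_comp)
  show "cyc4 (a, b, c, d) \<circ> cyc4 (d, c, b, a) = id" "cyc4 (d, c, b, a) \<circ> cyc4 (a, b, c, d) = id"
    by (simp_all add: fun_eq_iff transpose_commute)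
qed

text \<open>The adjoint of a right translation is the translation by the inverse, and reversing a
  tuple inverts its 4-cycle.\<close>

lemma cyc4_sum_symmetric:
  assumes "B \<subseteq> {1..n}"
  shows "ip (Sym n) (cyc4_sum B f) g = ip (Sym n) f (cyc4_sum B g)"
proof -
  have inS: "cyc4 z \<in> Sym n" if "z \<in> tuples4 B B B B" for z
    using permutes_subset[OF cyc4_permutes[OF that] assms] by (simp add: Sym_def)
  have "ip (Sym n) (cyc4_sum B f) g = (\<Sum>z\<in>tuples4 B B B B. ip (Sym n) (\<lambda>x. f (x \<circ> cyc4 z)) g)"
    unfolding cyc4_sum_def by (simp add: ip_sum_left)
  also have "\<dots> = (\<Sum>z\<in>tuples4 B B B B. ip (Sym n) f (\<lambda>x. g (x \<circ> inv (cyc4 z))))"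
    by (intro sum.cong refl ip_translate_left inS)
  also have "\<dots> = (\<Sum>z\<in>tuples4 B B B B. ip (Sym n) f (\<lambda>x. g (x \<circ> cyc4 z)))"
    by (rule sum.reindex_bij_witness[where i = "\<lambda>(a, b, c, d). (d, c, b, a)" and j = "\<lambda>(a, b, c, d). (d, c, b, a)"])
      (auto simp: tuples4_def cyc4_reverse simp del: cyc4.simps)
  also have "\<dots> = ip (Sym n) f (cyc4_sum B g)"
    unfolding cyc4_sum_def by (simp add: ip_sum_right)
  finally show ?thesis .
qed

section \<open>Averages over subgroups and the filtration defined by them\<close>

lemma sym_sum_sum: "sym_sum A (\<lambda>x. \<Sum>i\<in>I. F i x) x = (\<Sum>i\<in>I. sym_sum A (F i) x)"
  unfolding sym_sum_def by (rule sum.swap)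

lemma no_inv_supp: "f \<in> no_inv n B k \<Longrightarrow> x \<notin> Sym n \<Longrightarrow> f x = 0"
  by (simp add: no_inv_def)

lemma no_inv_sum:
  assumes "\<And>i. i \<in> I \<Longrightarrow> F i \<in> no_inv n B k"
  shows "(\<lambda>x. \<Sum>i\<in>I. F i x) \<in> no_inv n B k"
  using assms by (simp add: no_inv_def sym_sum_sum)

lemma no_inv_antimono: "D \<subseteq> B \<Longrightarrow> no_inv n B k \<subseteq> no_inv n D k"
  by (auto simp: no_inv_def)

lemma permutes_conj:
  assumes "bij u" "p permutes A"
  shows "u \<circ> p \<circ> inv u permutes u ` A"
proof -
  have "bij (u \<circ> p \<circ> inv u)"
    using assms by (intro bij_comp bij_imp_bij_inv permutes_bij)
  moreover have "(u \<circ> p \<circ> inv u) x = x" if "x \<notin> u ` A" for x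
  proof -
    have "inv u x \<notin> A" using that assms(1) by (metis bij_inv_eq_iff imageI)
    then show ?thesis
      using assms by (simp add: permutes_not_in bij_is_surj surj_f_inv_f)
  qed
  ultimately show ?thesis by (simp add: bij_iff permutes_def)
qed

lemma sym_sum_translate:
  assumes "bij s"
  shows "sym_sum A (\<lambda>x. f (x \<circ> s)) x = sym_sum (inv s ` A) f (x \<circ> s)"
  unfolding sym_sum_def
proof (rule sum.reindex_bij_witness[where i = "\<lambda>\<sigma>. s \<circ> \<sigma> \<circ> inv s" and j = "\<lambda>\<tau>. inv s \<circ> \<tau> \<circ> s"])
  have o: "s \<circ> inv s = id" "inv s \<circ> s = id"
    using bij_is_surj[OF assms] bij_is_inj[OF assms] unfolding surj_iff inj_iff by auto
  then have o': "s (inv s y) = y" "inv s (s y) = y" for y by (metis comp_apply id_apply)+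
  have ii: "inv (inv s) = s" using assms by (rule inv_inv_eq)
  fix \<tau> :: "nat \<Rightarrow> nat"
  show "s \<circ> (inv s \<circ> \<tau> \<circ> s) \<circ> inv s = \<tau>" "inv s \<circ> (s \<circ> \<tau> \<circ> inv s) \<circ> s = \<tau>"
    by (simp_all add: fun_eq_iff o')
  show "f (x \<circ> s \<circ> (inv s \<circ> \<tau> \<circ> s)) = f (x \<circ> \<tau> \<circ> s)"
    by (simp add: o' comp_def)
  show "inv s \<circ> \<tau> \<circ> s \<in> {\<tau>. \<tau> permutes inv s ` A}" if "\<tau> \<in> {\<tau>. \<tau> permutes A}"
    using permutes_conj[OF bij_imp_bij_inv[OF assms], of \<tau> A] that by (simp add: ii)
  have "s ` inv s ` A = A" by (simp add: image_image o')
  then show "s \<circ> \<tau> \<circ> inv s \<in> {\<tau>. \<tau> permutes A}" if "\<tau> \<in> {\<tau>. \<tau> permutes inv s ` A}"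
    using permutes_conj[OF assms, of \<tau> "inv s ` A"] that by simp
qed

text \<open>Conjugation by \<open>s\<close> permutes the subsets of \<open>B\<close> of size
  \<open>k\<close>, so the family of averaging conditions is stable although a single condition need
  not be.\<close>

lemma no_inv_translate:
  assumes "f \<in> no_inv n B k" "s permutes B" "B \<subseteq> {1..n}"
  shows "(\<lambda>x. f (x \<circ> s)) \<in> no_inv n B k"
proof -
  have bij: "bij s" using assms(2) by (rule permutes_bij)
  have "sym_sum A (\<lambda>x. f (x \<circ> s)) x = 0" if "A \<subseteq> B" "card A = k" "x \<in> Sym n" for A x
  proof -
    have "inv s ` A \<subseteq> B"
      using that(1) permutes_image[OF permutes_inv[OF assms(2)]] by blast
    moreover have "card (inv s ` A) = k"
      using that(2) bij_imp_bij_inv[OF bij] by (metis bij_betw_imp_inj_on card_image inj_on_subset subset_UNIV)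
    ultimately show ?thesis
      using assms(1) that(3) comp_in_Sym_iff[OF assms(2,3), of x]
      by (simp add: sym_sum_translate[OF bij] no_inv_def)
  qed
  moreover have "f (x \<circ> s) = 0" if "x \<notin> Sym n" for x
    using assms(1) that comp_in_Sym_iff[OF assms(2,3), of x] by (simp add: no_inv_def)
  ultimately show ?thesis by (simp add: no_inv_def)
qed

lemma sym_sum_in_no_inv:
  assumes "f \<in> no_inv n B k" "A \<subseteq> B" "B \<subseteq> {1..n}"
  shows "sym_sum A f \<in> no_inv n B k"
proof -
  have "(\<lambda>x. \<Sum>\<tau>\<in>{\<tau>. \<tau> permutes A}. f (x \<circ> \<tau>)) \<in> no_inv n B k"
    using assms by (intro no_inv_sum no_inv_translate) (auto intro: permutes_subset)
  then show ?thesis by (simp add: sym_sum_def[abs_def])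
qed

lemma cyc4_sum_in_no_inv:
  assumes "f \<in> no_inv n B k" "B \<subseteq> {1..n}"
  shows "cyc4_sum B f \<in> no_inv n B k"
proof -
  have "(\<lambda>x. \<Sum>z\<in>tuples4 B B B B. f (x \<circ> cyc4 z)) \<in> no_inv n B k"
    using assms by (intro no_inv_sum no_inv_translate) (auto intro: cyc4_permutes)
  then show ?thesis by (simp add: cyc4_sum_def[abs_def])
qed

lemma transpose_conj:
  assumes "inj u"
  shows "transpose (u a) (u b) (u x) = u (transpose a b x)"
  using assms by (auto simp: Transposition.transpose_def inj_eq)

lemma cyc4_conj:
  assumes "inj u"
  shows "cyc4 (u a, u b, u c, u d) \<circ> u = u \<circ> cyc4 (a, b, c, d)"
  by (simp add: fun_eq_iff transpose_conj[OF assms])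

text \<open>The 4-cycles inside \<open>B\<close> are stable under conjugation by
  \<open>Sym B\<close>, so their sum is central there.\<close>

lemma cyc4_sum_translate:
  assumes "u permutes B"
  shows "cyc4_sum B (\<lambda>x. f (x \<circ> u)) x = cyc4_sum B f (x \<circ> u)"
  unfolding cyc4_sum_def
proof (rule sum.reindex_bij_witness[where i = "\<lambda>(a, b, c, d). (u a, u b, u c, u d)"
      and j = "\<lambda>(a, b, c, d). (inv u a, inv u b, inv u c, inv u d)"])
  have inj: "inj u" using assms by (rule permutes_inj)
  have o: "u (inv u y) = y" "inv u (u y) = y" for y using permutes_inverses[OF assms] by auto
  have uB: "u y \<in> B \<longleftrightarrow> y \<in> B" "inv u y \<in> B \<longleftrightarrow> y \<in> B" for y
    using permutes_in_image[OF assms] permutes_in_image[OF permutes_inv[OF assms]] by auto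
  have eq: "u y = u z \<longleftrightarrow> y = z" "inv u y = inv u z \<longleftrightarrow> y = z" for y z
    using o by metis+
  fix z
  show "(case case z of (a, b, c, d) \<Rightarrow> (inv u a, inv u b, inv u c, inv u d) of (a, b, c, d) \<Rightarrow> (u a, u b, u c, u d)) = z"
    "(case case z of (a, b, c, d) \<Rightarrow> (u a, u b, u c, u d) of (a, b, c, d) \<Rightarrow> (inv u a, inv u b, inv u c, inv u d)) = z"
    by (cases z; simp add: o)+
  show "(case z of (a, b, c, d) \<Rightarrow> (inv u a, inv u b, inv u c, inv u d)) \<in> tuples4 B B B B" if "z \<in> tuples4 B B B B"
    using that by (cases z) (simp add: tuples4_def uB eq)
  show "(case z of (a, b, c, d) \<Rightarrow> (u a, u b, u c, u d)) \<in> tuples4 B B B B" if "z \<in> tuples4 B B B B"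
    using that by (cases z) (simp add: tuples4_def uB eq)
  obtain a b c d where z: "z = (a, b, c, d)" by (cases z)
  have "u \<circ> cyc4 (inv u a, inv u b, inv u c, inv u d) = cyc4 (a, b, c, d) \<circ> u"
    using cyc4_conj[OF inj, of "inv u a" "inv u b" "inv u c" "inv u d"] by (simp only: o)
  then show "f (x \<circ> u \<circ> cyc4 (case z of (a, b, c, d) \<Rightarrow> (inv u a, inv u b, inv u c, inv u d))) = f (x \<circ> cyc4 z \<circ> u)"
    by (simp only: z prod.case comp_assoc)
qed

text \<open>Centrality again; as a consequence, averaging an eigenvector over \<open>Sym A\<close>
  keeps its eigenvalue.\<close>

lemma cyc4_sum_sym_sum:
  assumes "A \<subseteq> B"
  shows "cyc4_sum B (sym_sum A f) = sym_sum A (cyc4_sum B f)"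
proof
  fix x
  have "cyc4_sum B (sym_sum A f) x = (\<Sum>\<tau>\<in>{\<tau>. \<tau> permutes A}. cyc4_sum B (\<lambda>x. f (x \<circ> \<tau>)) x)"
    unfolding cyc4_sum_def sym_sum_def by (rule sum.swap)
  also have "\<dots> = sym_sum A (cyc4_sum B f) x"
    unfolding sym_sum_def using assms by (intro sum.cong refl cyc4_sum_translate) (auto intro: permutes_subset)
  finally show "cyc4_sum B (sym_sum A f) x = sym_sum A (cyc4_sum B f) x" .
qed

lemma sym_sum_invariant:
  assumes "\<sigma> permutes A"
  shows "sym_sum A f (x \<circ> \<sigma>) = sym_sum A f x"
proof -
  have "(\<Sum>\<tau>\<in>{\<tau>. \<tau> permutes A}. f (x \<circ> \<tau>)) = (\<Sum>\<tau>\<in>{\<tau>. \<tau> permutes A}. f (x \<circ> (\<sigma> \<circ> \<tau>)))"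
    by (rule setum_permutations_compose_left[OF assms])
  then show ?thesis by (simp add: sym_sum_def comp_assoc)
qed

text \<open>The transpositions \<open>(b a)\<close>, together with the identity for
  \<open>a = b\<close>, represent the cosets of \<open>Sym A\<close> in
  \<open>Sym (insert b A)\<close>.\<close>

lemma sym_sum_insert:
  assumes "finite A" "b \<notin> A"
  shows "sym_sum (insert b A) f x = (\<Sum>a\<in>insert b A. sym_sum A f (x \<circ> transpose b a))"
  unfolding sym_sum_def by (simp only: sum_over_permutations_insert[OF assms] comp_assoc)

text \<open>Coset expansion of the vanishing average: the trivial representative
  \<open>transpose b b\<close> contributes \<open>v x\<close>, and the star must cancel it.\<close>

lemma star_eq_neg:
  assumes v: "v \<in> no_inv n B (Suc (card A))" and A: "A \<subseteq> B" "B \<subseteq> {1..n}" "b \<in> B - A"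
    and inv: "\<And>\<tau> x. \<tau> permutes A \<Longrightarrow> v (x \<circ> \<tau>) = v x"
  shows "(\<Sum>a\<in>A. v (x \<circ> transpose b a)) = - v x"
proof (cases "x \<in> Sym n")
  case True
  have fin: "finite A" using A by (intro finite_subset[of A "{1..n}"]) auto
  have "sym_sum (insert b A) v x = 0"
    using v True A fin by (simp add: no_inv_def)
  moreover have "sym_sum A v y = fact (card A) * v y" for y
    using fin by (simp add: sym_sum_def inv card_permutations)
  ultimately have "fact (card A) * (\<Sum>a\<in>insert b A. v (x \<circ> transpose b a)) = 0"
    using A fin by (simp only: sym_sum_insert sum_distrib_left) (simp add: sym_sum_insert)
  then have "(\<Sum>a\<in>insert b A. v (x \<circ> transpose b a)) = 0" by simp
  then show ?thesis using A fin by simp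
next
  case False
  have "v (x \<circ> transpose b a) = 0" if "a \<in> A" for a
  proof -
    have "x \<circ> transpose b a \<notin> Sym n"
      using False comp_in_Sym_iff[OF transpose_permutes[of b B a] A(2), of x] that A by auto
    then show ?thesis by (rule no_inv_supp[OF v])
  qed
  then show ?thesis using no_inv_supp[OF v False] by simp
qed

text \<open>An average over a set with one more point is a sum of translates of averages over the
  smaller set, so the spaces increase with \<open>k\<close>.\<close>

lemma no_inv_Suc:
  assumes "B \<subseteq> {1..n}"
  shows "no_inv n B k \<subseteq> no_inv n B (Suc k)"
proof
  fix f assume f: "f \<in> no_inv n B k"
  have "sym_sum A f x = 0" if A: "A \<subseteq> B" "card A = Suc k" and x: "x \<in> Sym n" for A x
  proof -
    obtain b A' where b: "A = insert b A'" "b \<notin> A'" "card A' = k" using A(2) by (meson card_Suc_eq)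
    have fin: "finite A'" using A(2) b by (metis card_gt_0_iff finite_insert zero_less_Suc)
    have "x \<circ> transpose b a \<in> Sym n" if "a \<in> A" for a
      using comp_in_Sym_iff[OF transpose_permutes[of b B a] assms] that A b x by auto
    then show ?thesis
      unfolding b(1) sym_sum_insert[OF fin b(2)]
      using f A b by (intro sum.neutral) (auto simp: no_inv_def)
  qed
  then show "f \<in> no_inv n B (Suc k)" using f by (simp add: no_inv_def)
qed

text \<open>The symmetric group of one point is trivial, so averaging over it is evaluation: the
  filtration starts at zero.\<close>

lemma no_inv_one:
  assumes "f \<in> no_inv n B 1" "B \<noteq> {}"
  shows "f = (\<lambda>_. 0)"
proof
  fix x
  obtain b where b: "b \<in> B" using assms(2) by blast
  have "sym_sum {b} f x = f x" by (simp add: sym_sum_def)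
  then show "f x = 0" using assms(1) b no_inv_supp[OF assms(1)] by (cases "x \<in> Sym n") (auto simp: no_inv_def)
qed

section \<open>The lower order terms of the peeling step\<close>

lemma transposition_sum_ge:
  assumes D: "D \<subseteq> {1..n}" "card D = j"
  shows "ip (Sym n) (\<lambda>x. \<Sum>b\<in>D. \<Sum>c\<in>D - {b}. v (x \<circ> transpose b c)) v \<ge> - (real j * (real j - 1)) * ip (Sym n) v v"
proof -
  have fin: "finite D" using D by (intro finite_subset[of D "{1..n}"]) auto
  have dj: "real (card (D - {b})) = real j - 1" if "b \<in> D" for b
  proof -
    have "card D > 0" using that fin by (auto simp: card_gt_0_iff)
    then show ?thesis using that D fin by (simp add: card_Diff_singleton of_nat_diff)
  qed
  have "- (real j * (real j - 1)) * ip (Sym n) v v = (\<Sum>b\<in>D. \<Sum>c\<in>D - {b}. - ip (Sym n) v v)"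
    using D(2) by (simp only: sum_constant dj cong: sum.cong) (simp add: algebra_simps)
  also have "\<dots> \<le> (\<Sum>b\<in>D. \<Sum>c\<in>D - {b}. ip (Sym n) (\<lambda>x. v (x \<circ> transpose b c)) v)"
  proof (intro sum_mono)
    fix b c assume "b \<in> D" "c \<in> D - {b}"
    then have "transpose b c \<in> Sym n"
      using D by (auto simp: Sym_def intro!: transpose_permutes)
    from abs_ip_translate_le[OF this, of v]
    show "- ip (Sym n) v v \<le> ip (Sym n) (\<lambda>x. v (x \<circ> transpose b c)) v" by linarith
  qed
  finally show ?thesis by (simp add: ip_sum_left)
qed

text \<open>The left-hand side plus \<open>j * (j - 1) * ip (Sym n) v v\<close> is the sum of the squared norms of
  the star transposition sums applied to \<open>v\<close>.\<close>

lemma three_cycle_sum_ge: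
  assumes D: "D \<subseteq> {1..n}" "card D = j"
  shows "ip (Sym n) (\<lambda>x. \<Sum>b\<in>D. \<Sum>c\<in>D - {b}. \<Sum>d\<in>D - {b, c}. v (x \<circ> transpose b c \<circ> transpose c d)) v
    \<ge> - (real j * (real j - 1)) * ip (Sym n) v v"
proof -
  have fin: "finite D" using D by (intro finite_subset[of D "{1..n}"]) auto
  have dj: "real (card (D - {b})) = real j - 1" if "b \<in> D" for b
  proof -
    have "card D > 0" using that fin by (auto simp: card_gt_0_iff)
    then show ?thesis using that D fin by (simp add: card_Diff_singleton of_nat_diff)
  qed
  define t where "t b c d = ip (Sym n) (\<lambda>x. v (x \<circ> transpose b c \<circ> transpose c d)) v" for b c d
  define w where "w c = (\<lambda>x. \<Sum>d\<in>D - {c}. v (x \<circ> transpose c d))" for c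
  \<comment> \<open>Moving one transposition to the other side yields \<open>(c b) (c d)\<close>:
    the identity if \<open>b = d\<close>, otherwise a 3-cycle. These are the terms of the expanded
    squared norm of a star.\<close>
  have pair: "ip (Sym n) (\<lambda>x. v (x \<circ> transpose c d)) (\<lambda>x. v (x \<circ> transpose c b))
      = (if b = d then ip (Sym n) v v else t b c d)" if "c \<in> D" "b \<in> D" "d \<in> D" for b c d
  proof -
    have cb: "transpose c b \<in> Sym n" using that D by (auto simp: Sym_def intro!: transpose_permutes)
    have "ip (Sym n) (\<lambda>x. v (x \<circ> transpose c d)) (\<lambda>x. v (x \<circ> transpose c b))
      = ip (Sym n) (\<lambda>x. v (x \<circ> transpose c b)) (\<lambda>x. v (x \<circ> transpose c d))" by (rule ip_commute)
    also have "\<dots> = ip (Sym n) v (\<lambda>x. v (x \<circ> transpose c b \<circ> transpose c d))"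
      using ip_translate_left[OF cb, of v "\<lambda>x. v (x \<circ> transpose c d)"] by simp
    also have "\<dots> = ip (Sym n) (\<lambda>x. v (x \<circ> transpose c b \<circ> transpose c d)) v" by (rule ip_commute)
    also have "\<dots> = (if b = d then ip (Sym n) v v else t b c d)"
      by (simp add: t_def transpose_commute comp_assoc)
    finally show ?thesis .
  qed
  have "0 \<le> (\<Sum>c\<in>D. ip (Sym n) (w c) (w c))" by (intro sum_nonneg ip_self_nonneg)
  also have "\<dots> = (\<Sum>c\<in>D. \<Sum>b\<in>D - {c}. \<Sum>d\<in>D - {c}. if b = d then ip (Sym n) v v else t b c d)"
  proof (intro sum.cong refl)
    fix c assume c: "c \<in> D"
    have "ip (Sym n) (w c) (w c) = (\<Sum>d\<in>D - {c}. \<Sum>b\<in>D - {c}. ip (Sym n) (\<lambda>x. v (x \<circ> transpose c d)) (\<lambda>x. v (x \<circ> transpose c b)))"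
      unfolding w_def by (simp only: ip_sum_left ip_sum_right)
    also have "\<dots> = (\<Sum>d\<in>D - {c}. \<Sum>b\<in>D - {c}. if b = d then ip (Sym n) v v else t b c d)"
      using c by (intro sum.cong refl pair) auto
    also have "\<dots> = (\<Sum>b\<in>D - {c}. \<Sum>d\<in>D - {c}. if b = d then ip (Sym n) v v else t b c d)"
      by (rule sum.swap)
    finally show "ip (Sym n) (w c) (w c) = \<dots>" .
  qed
  also have "\<dots> = (\<Sum>c\<in>D. \<Sum>b\<in>D - {c}. ip (Sym n) v v + (\<Sum>d\<in>D - {b, c}. t b c d))"
  proof (intro sum.cong refl)
    fix c b assume cb: "c \<in> D" "b \<in> D - {c}"
    have "(\<Sum>d\<in>D - {c}. if b = d then ip (Sym n) v v else t b c d)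
      = ip (Sym n) v v + (\<Sum>d\<in>D - {c} - {b}. if b = d then ip (Sym n) v v else t b c d)"
      using fin cb by (subst sum.remove[of _ b]) auto
    also have "(\<Sum>d\<in>D - {c} - {b}. if b = d then ip (Sym n) v v else t b c d) = (\<Sum>d\<in>D - {b, c}. t b c d)"
      by (intro sum.cong) auto
    finally show "(\<Sum>d\<in>D - {c}. if b = d then ip (Sym n) v v else t b c d) = ip (Sym n) v v + (\<Sum>d\<in>D - {b, c}. t b c d)" .
  qed
  also have "\<dots> = (\<Sum>c\<in>D. \<Sum>b\<in>D - {c}. ip (Sym n) v v) + (\<Sum>c\<in>D. \<Sum>b\<in>D - {c}. \<Sum>d\<in>D - {b, c}. t b c d)"
    by (simp add: sum.distrib)
  also have "(\<Sum>c\<in>D. \<Sum>b\<in>D - {c}. ip (Sym n) v v) = real j * (real j - 1) * ip (Sym n) v v"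
    using D(2) by (simp only: sum_constant dj mult.assoc cong: sum.cong)
  also have "(\<Sum>c\<in>D. \<Sum>b\<in>D - {c}. \<Sum>d\<in>D - {b, c}. t b c d) = (\<Sum>b\<in>D. \<Sum>c\<in>D - {b}. \<Sum>d\<in>D - {b, c}. t b c d)"
    by (rule sum_off_diagonal_swap[OF fin])
  finally show ?thesis by (simp add: ip_sum_left t_def)
qed

text \<open>For \<open>k \<ge> 2\<close> the transposition and 3-cycle sums enter with negative
  coefficients, so lower bounds for them suffice. Their costs \<open>4 * k - 6\<close> and
  \<open>4\<close>, in units of \<open>j * (j - 1)\<close>, add up with the \<open>2\<close> already
  present to \<open>4 * k\<close>.\<close>

lemma cyc4_peel_le:
  assumes v: "v \<in> no_inv n B (Suc k)" and A: "A \<subseteq> B" "B \<subseteq> {1..n}" "card A = k" "k \<ge> 2" "card (B - A) = j"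
    and inv: "\<And>\<tau> x. \<tau> permutes A \<Longrightarrow> v (x \<circ> \<tau>) = v x"
  shows "ip (Sym n) (cyc4_sum B v) v \<le>
    (real k * (real k - 1) * (real k - 2) * (real k - 3) - 4 * real j * (real k - 1) * (real k - 2)
      + 4 * real k * real j * (real j - 1)) * ip (Sym n) v v + ip (Sym n) (cyc4_sum (B - A) v) v"
proof -
  define D where "D = B - A"
  define s2 where "s2 = (\<lambda>x. \<Sum>b\<in>D. \<Sum>c\<in>D - {b}. v (x \<circ> transpose b c))"
  define s3 where "s3 = (\<lambda>x. \<Sum>b\<in>D. \<Sum>c\<in>D - {b}. \<Sum>d\<in>D - {b, c}. v (x \<circ> transpose b c \<circ> transpose c d))"
  define K where "K = real k * (real k - 1) * (real k - 2) * (real k - 3) - 4 * real j * (real k - 1) * (real k - 2)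
        + 2 * real j * (real j - 1)"
  have "finite B" using A(2) by (rule finite_subset) simp
  then have fin: "finite A" "finite D" using A(1) by (auto simp: D_def intro: finite_subset)
  have "cyc4_sum (A \<union> D) v x = K * v x - (4 * real k - 6) * s2 x - 4 * s3 x + cyc4_sum D v x" for x
    unfolding K_def s2_def s3_def
    by (rule cyc4_sum_peel[OF fin])
      (use A v in \<open>auto simp: D_def intro!: inv transpose_permutes star_eq_neg[OF _ A(1,2)]\<close>)
  moreover have "A \<union> D = B" using A by (auto simp: D_def)
  ultimately have "cyc4_sum B v = (\<lambda>x. K * v x - (4 * real k - 6) * s2 x - 4 * s3 x + cyc4_sum D v x)"
    by (simp add: fun_eq_iff)
  then have "ip (Sym n) (cyc4_sum B v) v = K * ip (Sym n) v v - (4 * real k - 6) * ip (Sym n) s2 v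
      - 4 * ip (Sym n) s3 v + ip (Sym n) (cyc4_sum D v) v"
    by (simp add: ip_linear)
  moreover have "ip (Sym n) s2 v \<ge> - (real j * (real j - 1)) * ip (Sym n) v v"
    unfolding s2_def using A by (intro transposition_sum_ge) (auto simp: D_def)
  then have "(4 * real k - 6) * ip (Sym n) s2 v \<ge> (4 * real k - 6) * (- (real j * (real j - 1)) * ip (Sym n) v v)"
    using A by (intro mult_left_mono) auto
  moreover have "ip (Sym n) s3 v \<ge> - (real j * (real j - 1)) * ip (Sym n) v v"
    unfolding s3_def using A by (intro three_cycle_sum_ge) (auto simp: D_def)
  ultimately show ?thesis
    unfolding D_def[symmetric] K_def by (simp add: algebra_simps)
qed

section \<open>Eigenvalues of the 4-cycle sum\<close>

definition coset :: "nat set \<Rightarrow> (nat \<Rightarrow> nat) \<Rightarrow> (nat \<Rightarrow> nat) set" where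
  "coset A x = (\<lambda>\<tau>. x \<circ> \<tau>) ` {\<tau>. \<tau> permutes A}"

text \<open>Test vectors for \<open>no_inv\<close>: pairing with the indicator of
  \<open>coset A x\<close> is \<open>sym_sum A\<close> at \<open>x\<close>. Their number bounds the
  multiplicity of a level.\<close>

definition coset_indicators :: "nat \<Rightarrow> nat set \<Rightarrow> nat \<Rightarrow> ((nat \<Rightarrow> nat) \<Rightarrow> real) set" where
  "coset_indicators n B k = (\<Union>A\<in>{A. A \<subseteq> B \<and> card A = k}. indicator ` coset A ` Sym n)"

lemma inj_on_Sym_comp:
  assumes "x \<in> Sym n"
  shows "inj_on (\<lambda>\<tau>. x \<circ> \<tau>) T"
proof -
  have "inj x" using assms by (auto simp: Sym_def intro: permutes_inj)
  then show ?thesis by (auto simp: inj_on_def fun_eq_iff dest: injD)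
qed

lemma coset_subset_Sym:
  assumes "A \<subseteq> {1..n}" "x \<in> Sym n"
  shows "coset A x \<subseteq> Sym n"
  using comp_in_Sym_iff[OF _ assms(1)] assms(2) by (auto simp: coset_def)

lemma sym_sum_eq_ip:
  assumes "A \<subseteq> {1..n}" "x \<in> Sym n"
  shows "sym_sum A f x = ip (Sym n) f (indicator (coset A x))"
proof -
  have "ip (Sym n) f (indicator (coset A x)) = sum f (Sym n \<inter> coset A x)"
    unfolding ip_def using finite_Sym by (simp add: sum.inter_restrict indicator_def if_distrib cong: if_cong)
  also have "\<dots> = sum f (coset A x)"
    using coset_subset_Sym[OF assms] by (simp add: Int_absorb1)
  also have "\<dots> = sym_sum A f x"
    unfolding coset_def sym_sum_def by (simp add: sum.reindex[OF inj_on_Sym_comp[OF assms(2)]])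
  finally show ?thesis by simp
qed

lemma no_inv_eq_annihilator:
  assumes "B \<subseteq> {1..n}"
  shows "no_inv n B k = annihilator (Sym n) (coset_indicators n B k)"
proof -
  have "(\<forall>A\<subseteq>B. card A = k \<longrightarrow> (\<forall>x\<in>Sym n. sym_sum A f x = 0)) \<longleftrightarrow>
      (\<forall>g\<in>coset_indicators n B k. ip (Sym n) f g = 0)" for f
    using assms by (auto simp: coset_indicators_def sym_sum_eq_ip[OF order_trans[OF _ assms]])
  then show ?thesis by (simp add: no_inv_def annihilator_def)
qed

lemma card_cosets:
  assumes "A \<subseteq> {1..n}" "card A = k"
  shows "fact k * card (coset A ` Sym n) = fact n"
proof -
  have fin: "finite A" using assms finite_subset by blast
  have self: "x \<in> coset A x" for x
    unfolding coset_def using permutes_id[of A] by (intro image_eqI[of _ _ id]) auto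
  have "fact k * card (coset A ` Sym n) = card (\<Union> (coset A ` Sym n))"
  proof (rule card_partition)
    have sub: "\<Union> (coset A ` Sym n) \<subseteq> Sym n" using coset_subset_Sym[OF assms(1)] by blast
    show "finite (coset A ` Sym n)" by (simp add: finite_Sym)
    show "finite (\<Union> (coset A ` Sym n))" using sub finite_Sym finite_subset by blast
    show "card c = fact k" if c: "c \<in> coset A ` Sym n" for c
    proof -
      obtain x where "x \<in> Sym n" "c = coset A x" using c by blast
      then show ?thesis using fin assms(2)
        by (simp add: coset_def card_image[OF inj_on_Sym_comp] card_permutations)
    qed
    show "c1 \<inter> c2 = {}" if c: "c1 \<in> coset A ` Sym n" "c2 \<in> coset A ` Sym n" "c1 \<noteq> c2" for c1 c2
    proof (rule ccontr)
      assume "c1 \<inter> c2 \<noteq> {}"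
      moreover obtain x1 x2 where x: "c1 = coset A x1" "c2 = coset A x2" using c by blast
      ultimately obtain \<sigma> \<tau> where \<sigma>: "\<sigma> permutes A" "\<tau> permutes A" "x1 \<circ> \<sigma> = x2 \<circ> \<tau>"
        unfolding coset_def by auto
      have sub: "coset A (y \<circ> \<rho>) = coset A y" if "\<rho> permutes A" for y \<rho>
      proof -
        have "coset A (y \<circ> \<rho>) = (\<lambda>\<tau>. y \<circ> \<tau>) ` ((\<circ>) \<rho> ` {\<tau>. \<tau> permutes A})"
          by (simp add: coset_def image_image comp_assoc)
        also have "(\<circ>) \<rho> ` {\<tau>. \<tau> permutes A} = {\<tau>. \<tau> permutes A}"
          using image_compose_permutations_left[OF that] by (simp only: setcompr_eq_image)
        finally show ?thesis by (simp only: coset_def)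
      qed
      have "c1 = c2" using sub[OF \<sigma>(1), of x1] sub[OF \<sigma>(2), of x2] \<sigma>(3) x by simp
      then show False using c by simp
    qed
  qed
  also have "\<Union> (coset A ` Sym n) = Sym n"
    using coset_subset_Sym[OF assms(1)] self by blast
  finally show ?thesis by (simp add: card_Sym)
qed

lemma finite_coset_indicators: "finite B \<Longrightarrow> finite (coset_indicators n B k)"
  unfolding coset_indicators_def by (auto intro: finite_Sym)

lemma card_coset_indicators_le:
  "real (card (coset_indicators n {1..n} k)) \<le> real (n choose k) * (fact n / fact k)"
proof -
  let ?S = "{A. A \<subseteq> {1..n} \<and> card A = k}"
  have "card (coset_indicators n {1..n} k) \<le> (\<Sum>A\<in>?S. card ((indicator :: _ \<Rightarrow> _ \<Rightarrow> real) ` coset A ` Sym n))"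
    unfolding coset_indicators_def by (rule card_UN_le) simp
  also have "\<dots> \<le> (\<Sum>A\<in>?S. card (coset A ` Sym n))"
    by (intro sum_mono card_image_le) (simp add: finite_Sym)
  finally have "real (card (coset_indicators n {1..n} k)) \<le> real (\<Sum>A\<in>?S. card (coset A ` Sym n))"
    by (simp only: of_nat_le_iff)
  also have "\<dots> = (\<Sum>A\<in>?S. real (card (coset A ` Sym n)))" by (rule of_nat_sum)
  also have "\<dots> = (\<Sum>A\<in>?S. fact n / fact k)"
  proof (intro sum.cong refl)
    fix A assume "A \<in> ?S"
    then have "fact k * card (coset A ` Sym n) = fact n" using card_cosets by blast
    then have "real (fact k * card (coset A ` Sym n)) = real (fact n)" by (rule arg_cong)
    then show "real (card (coset A ` Sym n)) = fact n / fact k" by (simp add: field_simps)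
  qed
  also have "\<dots> = real (n choose k) * (fact n / fact k)"
    using n_subsets[of "{1..n}" k] by simp
  finally show ?thesis .
qed

section \<open>Upper bounds for the quadratic form of the 4-cycle sum\<close>

lemma card_tuples4:
  assumes "finite D" "card D = j"
  shows "real (card (tuples4 D D D D)) = real j * (real j - 1) * (real j - 2) * (real j - 3)"
proof -
  have c1: "real (card (D - {a})) = real j - 1" if "a \<in> D" for a
  proof -
    have "card {a} \<le> card D" using that assms by (intro card_mono) auto
    then show ?thesis using that assms by (simp add: card_Diff_subset of_nat_diff)
  qed
  have c2: "real (card (D - {a, b})) = real j - 2" if "a \<in> D" "b \<in> D - {a}" for a b
  proof -
    have "card {a, b} \<le> card D" using that assms by (intro card_mono) auto
    moreover have "card {a, b} = 2" using that by auto
    ultimately show ?thesis using that assms by (simp add: card_Diff_subset of_nat_diff)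
  qed
  have c3: "real (card (D - {a, b, c})) = real j - 3" if "a \<in> D" "b \<in> D - {a}" "c \<in> D - {a, b}" for a b c
  proof -
    have "card {a, b, c} \<le> card D" using that assms by (intro card_mono) auto
    moreover have "card {a, b, c} = 3" using that by auto
    ultimately show ?thesis using that assms by (simp add: card_Diff_subset of_nat_diff)
  qed
  have "real (card (tuples4 D D D D)) = (\<Sum>z\<in>tuples4 D D D D. 1)" by simp
  also have "\<dots> = (\<Sum>a\<in>D. \<Sum>b\<in>D - {a}. \<Sum>c\<in>D - {a, b}. \<Sum>d\<in>D - {a, b, c}. 1)"
    by (rule sum_tuples4) (fact assms)+
  also have "\<dots> = (\<Sum>a\<in>D. \<Sum>b\<in>D - {a}. \<Sum>c\<in>D - {a, b}. (real j - 3) * 1)"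
    by (intro sum.cong refl) (simp only: sum_constant c3)
  also have "\<dots> = (\<Sum>a\<in>D. \<Sum>b\<in>D - {a}. (real j - 2) * ((real j - 3) * 1))"
    by (intro sum.cong refl) (simp only: sum_constant c2)
  also have "\<dots> = (\<Sum>a\<in>D. (real j - 1) * ((real j - 2) * ((real j - 3) * 1)))"
    by (intro sum.cong refl) (simp only: sum_constant c1)
  finally show ?thesis using assms by simp
qed

lemma cyc4_sum_trivial_le:
  assumes "D \<subseteq> {1..n}" "card D = j"
  shows "ip (Sym n) (cyc4_sum D v) v \<le> real j * (real j - 1) * (real j - 2) * (real j - 3) * ip (Sym n) v v"
proof -
  have fin: "finite D" using assms(1) by (rule finite_subset) simp
  have "ip (Sym n) (cyc4_sum D v) v = (\<Sum>z\<in>tuples4 D D D D. ip (Sym n) (\<lambda>x. v (x \<circ> cyc4 z)) v)"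
    unfolding cyc4_sum_def by (rule ip_sum_left)
  also have "\<dots> \<le> (\<Sum>z\<in>tuples4 D D D D. ip (Sym n) v v)"
  proof (rule sum_mono)
    fix z assume "z \<in> tuples4 D D D D"
    then have "cyc4 z \<in> Sym n"
      using permutes_subset[OF cyc4_permutes assms(1)] by (simp add: Sym_def)
    from abs_ip_translate_le[OF this, of v]
    show "ip (Sym n) (\<lambda>x. v (x \<circ> cyc4 z)) v \<le> ip (Sym n) v v" by linarith
  qed
  finally show ?thesis by (simp add: card_tuples4[OF fin assms(2)])
qed

text \<open>The sign representation: for one-point sets the star relation says that every
  transposition of \<open>B\<close> changes the sign, and a 4-cycle is a product of three.\<close>

lemma cyc4_sum_alternating_le:
  assumes v: "v \<in> no_inv n B 2" and B: "B \<subseteq> {1..n}"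
  shows "ip (Sym n) (cyc4_sum B v) v \<le> 0"
proof -
  have flip: "v (x \<circ> transpose a b) = - v x" if "a \<in> B" "b \<in> B" "a \<noteq> b" for a b x
    using star_eq_neg[of v n B "{b}" a x] that v B by (simp add: numeral_2_eq_2)
  have "cyc4_sum B v x = (\<Sum>z\<in>tuples4 B B B B. - v x)" for x
    unfolding cyc4_sum_def
  proof (intro sum.cong refl)
    fix z assume z: "z \<in> tuples4 B B B B"
    obtain a b c d where "z = (a, b, c, d)" by (cases z)
    with z have "v (x \<circ> transpose a b \<circ> transpose b c \<circ> transpose c d) = - v x"
      by (simp add: flip tuples4_def)
    then show "v (x \<circ> cyc4 z) = - v x" using \<open>z = _\<close> by (simp add: comp_assoc)
  qed
  then have "cyc4_sum B v = (\<lambda>x. (- real (card (tuples4 B B B B))) * v x)"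
    by (simp add: fun_eq_iff)
  then have "ip (Sym n) (cyc4_sum B v) v = - real (card (tuples4 B B B B)) * ip (Sym n) v v"
    by (simp only: ip_scale_left)
  then show ?thesis using ip_self_nonneg[of "Sym n" v] by simp
qed

text \<open>\<open>v\<close> is the average of \<open>e\<close> over a \<open>Sym A\<close> for
  which it does not vanish: same eigenvalue, but invariant, so that peeling applies. The complement
  enters through a quadratic form, since \<open>v\<close> need not be an eigenvector there. Level 1
  is separate because peeling needs \<open>k \<ge> 2\<close>.\<close>

lemma cyc4_eigenvalue_cases:
  assumes e: "e \<in> no_inv n B (Suc k)" "e \<notin> no_inv n B k" "cyc4_sum B e = (\<lambda>x. \<theta> * e x)"
    and B: "B \<subseteq> {1..n}" and k: "k \<ge> 1"
  obtains (one) "k = 1" "\<theta> \<le> 0"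
    | (peel) A v where "k \<ge> 2" "A \<subseteq> B" "card A = k" "v \<in> no_inv n B (Suc k)" "ip (Sym n) v v > 0"
      "\<theta> * ip (Sym n) v v \<le>
        (real k * (real k - 1) * (real k - 2) * (real k - 3)
          - 4 * real (card (B - A)) * (real k - 1) * (real k - 2)
          + 4 * real k * real (card (B - A)) * (real (card (B - A)) - 1)) * ip (Sym n) v v
        + ip (Sym n) (cyc4_sum (B - A) v) v"
proof -
  obtain A x where A: "A \<subseteq> B" "card A = k" "x \<in> Sym n" "sym_sum A e x \<noteq> 0"
    using e(1,2) by (auto simp: no_inv_def)
  define v where "v = sym_sum A e"
  have v: "v \<in> no_inv n B (Suc k)" unfolding v_def by (rule sym_sum_in_no_inv[OF e(1) A(1) B])
  have pos: "ip (Sym n) v v > 0" using A(3,4) by (intro ip_self_pos[OF finite_Sym]) (auto simp: v_def)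
  have "cyc4_sum B v = (\<lambda>x. \<theta> * v x)"
    unfolding v_def cyc4_sum_sym_sum[OF A(1)] e(3)
    by (simp add: sym_sum_def[abs_def] sum_distrib_left)
  then have \<theta>: "ip (Sym n) (cyc4_sum B v) v = \<theta> * ip (Sym n) v v" by (simp add: ip_linear)
  show thesis
  proof (cases "k = 1")
    case True
    have "\<theta> * ip (Sym n) v v \<le> 0"
      using cyc4_sum_alternating_le[of v n B] v B True \<theta> by (simp add: numeral_2_eq_2)
    then show thesis using one True pos by (simp add: mult_le_0_iff)
  next
    case False
    have "v (x \<circ> \<tau>) = v x" if "\<tau> permutes A" for \<tau> x
      unfolding v_def by (rule sym_sum_invariant[OF that])
    from cyc4_peel_le[OF v A(1) B A(2) _ refl this] False k
    show thesis using peel[OF _ A(1,2) v pos] \<theta> by simp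
  qed
qed

text \<open>In terms of diagrams with \<open>m\<close> boxes and rows of length at most
  \<open>k\<close>, the first summand charges each box with
  \<open>(k - 1) * (k - 2) * (k - 3)\<close>, its share of the falling factorial of a longest row.
  The second pays for the error \<open>4 * k * j * (j - 1)\<close> of all peeling steps
  together.\<close>

lemma cyc4_sum_le:
  assumes "B \<subseteq> {1..n}" "card B = m" "k \<ge> 1" "f \<in> no_inv n B (Suc k)"
  shows "ip (Sym n) (cyc4_sum B f) f \<le>
    (real m * ((real k - 1) * (real k - 2) * (real k - 3)) + 4 / 3 * (real m * (real m - 1) * (real m - 2))) * ip (Sym n) f f"
  using assms
proof (induction m arbitrary: B k f rule: less_induct)
  case (less m)
  note B = less.prems(1)
  have fin: "finite B" using B by (rule finite_subset) simp
  show ?case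
  proof (cases "\<exists>x\<in>Sym n. f x \<noteq> 0")
    case False
    then have "ip (Sym n) g f = 0" for g by (simp add: ip_def)
    then show ?thesis by simp
  next
    case True
    then obtain x0 where x0: "x0 \<in> Sym n" "f x0 \<noteq> 0" by blast
    have inv: "cyc4_sum B g \<in> annihilator (Sym n) (coset_indicators n B (Suc k))"
      if "g \<in> annihilator (Sym n) (coset_indicators n B (Suc k))" for g
      using cyc4_sum_in_no_inv[OF _ B, of g "Suc k"] that by (simp add: no_inv_eq_annihilator[OF B])
    have fA: "f \<in> annihilator (Sym n) (coset_indicators n B (Suc k))"
      using less.prems(4) by (simp add: no_inv_eq_annihilator[OF B])
    obtain e \<theta> where e: "e \<in> no_inv n B (Suc k)" "ip (Sym n) e e = 1" "cyc4_sum B e = (\<lambda>x. \<theta> * e x)"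
      and max: "ip (Sym n) (cyc4_sum B f) f \<le> \<theta> * ip (Sym n) f f"
      using max_eigenvector_exists[where Q = "cyc4_sum B", OF finite_Sym cyc4_sum_linear cyc4_sum_continuous
          cyc4_sum_symmetric[OF B] inv fA x0] less.prems(4) by (metis no_inv_eq_annihilator[OF B])
    define b where "b m k = real m * ((real k - 1) * (real k - 2) * (real k - 3)) + 4 / 3 * (real m * (real m - 1) * (real m - 2))" for m k :: nat
    have "\<theta> \<le> b m k"
    proof (cases "B = {}")
      case True
      then have "\<theta> = 0 \<or> (\<forall>x. e x = 0)" using e(3) by (simp add: cyc4_sum_def tuples4_def fun_eq_iff)
      moreover have "\<not> (\<forall>x. e x = 0)"
      proof
        assume "\<forall>x. e x = 0"
        then show False using e(2) by (simp add: ip_def)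
      qed
      ultimately have "\<theta> = 0" by auto
      moreover have "m = 0" using True less.prems(2) by simp
      ultimately show ?thesis by (simp add: b_def)
    next
      case False
      \<comment> \<open>The maximal eigenvector may belong to a level \<open>k'\<close> below
        \<open>k\<close>. Peeling is done at its true level; the bound is monotone in
        \<open>k\<close> because the product vanishes at 1, 2, 3 and increases afterwards.\<close>
      define l where "l = (LEAST l. e \<in> no_inv n B l)"
      have l: "e \<in> no_inv n B l" "l \<le> Suc k" "\<And>i. i < l \<Longrightarrow> e \<notin> no_inv n B i"
        unfolding l_def using e(1) by (auto intro: LeastI Least_le dest: not_less_Least)
      have "e \<notin> no_inv n B 1" using no_inv_one[of e n B] False e(2) by (auto simp: ip_def)
      moreover from this have "e \<notin> no_inv n B 0" using no_inv_Suc[OF B, of 0] by auto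
      ultimately have "l \<noteq> 0" "l \<noteq> 1" using l(1) by metis+
      then obtain k' where k': "l = Suc k'" "k' \<ge> 1" by (cases l) auto
      have "k' \<le> k" using k' l(2) by simp
      have mono: "b m k' \<le> b m k"
      proof -
        have "(real k' - 1) * (real k' - 2) * (real k' - 3) \<le> (real k - 1) * (real k - 2) * (real k - 3)"
        proof (cases "k' \<ge> 3")
          case True
          then show ?thesis using \<open>k' \<le> k\<close> by (intro mult_mono mult_nonneg_nonneg) auto
        next
          case False
          then have "k' = 1 \<or> k' = 2" using k' by linarith
          then have "(real k' - 1) * (real k' - 2) * (real k' - 3) = 0" by auto
          moreover have "0 \<le> (real k - 1) * (real k - 2) * (real k - 3)"
          proof (cases "k \<ge> 3")
            case True
            then show ?thesis by (intro mult_nonneg_nonneg) auto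
          next
            case False
            then have "k = 1 \<or> k = 2" using less.prems(3) by linarith
            then show ?thesis by auto
          qed
          ultimately show ?thesis by linarith
        qed
        then show ?thesis unfolding b_def by (intro add_right_mono mult_left_mono) auto
      qed
      show ?thesis
      proof (rule cyc4_eigenvalue_cases[of e n B k' \<theta>])
        show "e \<in> no_inv n B (Suc k')" "e \<notin> no_inv n B k'" using l k' by auto
      next
        assume k1: "k' = 1" and "\<theta> \<le> 0"
        have "b m 1 \<ge> 0"
        proof (cases "m \<ge> 2")
          case False
          then have "m = 0 \<or> m = 1" by linarith
          then show ?thesis by (auto simp: b_def)
        qed (auto simp: b_def)
        then show ?thesis using k1 mono \<open>\<theta> \<le> 0\<close> by simp
      next
        fix A v
        define j where "j = card (B - A)"
        assume A: "k' \<ge> 2" "A \<subseteq> B" "card A = k'" and v: "v \<in> no_inv n B (Suc k')" "ip (Sym n) v v > 0"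
          and le: "\<theta> * ip (Sym n) v v \<le>
            (real k' * (real k' - 1) * (real k' - 2) * (real k' - 3)
              - 4 * real (card (B - A)) * (real k' - 1) * (real k' - 2)
              + 4 * real k' * real (card (B - A)) * (real (card (B - A)) - 1)) * ip (Sym n) v v
            + ip (Sym n) (cyc4_sum (B - A) v) v"
        have "finite A" using A(2) fin finite_subset by blast
        then have m: "m = k' + j" using A less.prems(2) fin card_mono[OF fin A(2)]
          by (simp add: j_def card_Diff_subset)
        \<comment> \<open>The averaging conditions pass to subsets of \<open>B - A\<close>, which is
          all that the induction hypothesis asks of \<open>v\<close>.\<close>
        have "v \<in> no_inv n (B - A) (Suc k')" using v(1) no_inv_antimono[of "B - A" B n "Suc k'"] by blast
        moreover have "j < m" using m k' by simp
        moreover have "B - A \<subseteq> {1..n}" using B by blast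
        ultimately have "ip (Sym n) (cyc4_sum (B - A) v) v \<le> b j k' * ip (Sym n) v v"
          unfolding b_def by (intro less.IH k'(2)) (simp_all add: j_def)
        then have "\<theta> * ip (Sym n) v v \<le> (real k' * (real k' - 1) * (real k' - 2) * (real k' - 3)
              - 4 * real j * (real k' - 1) * (real k' - 2)
              + 4 * real k' * real j * (real j - 1) + b j k') * ip (Sym n) v v"
          using le by (simp add: j_def algebra_simps)
        then have "\<theta> \<le> real k' * (real k' - 1) * (real k' - 2) * (real k' - 3)
              - 4 * real j * (real k' - 1) * (real k' - 2)
              + 4 * real k' * real j * (real j - 1) + b j k'"
          using v(2) by (simp only: mult_le_cancel_right_pos)
        \<comment> \<open>Vandermonde for the falling factorial of \<open>k' + j\<close> of order 3:
          its term \<open>3 * k' * j * (j - 1)\<close>, times \<open>4 / 3\<close>, is exactly the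
          error of this step. This is the origin of \<open>4 / 3\<close>; the other mixed terms are
          to spare.\<close>
        also have "\<dots> = b m k' - 4 * real j * (real k' - 1) * (real k' - 2)
            - 4 / 3 * (3 * real j * real k' * (real k' - 1) + real k' * (real k' - 1) * (real k' - 2))"
          unfolding b_def m of_nat_add by algebra
        also have "\<dots> \<le> b m k'"
        proof -
          have "0 \<le> 4 * real j * (real k' - 1) * (real k' - 2)"
            "0 \<le> 3 * real j * real k' * (real k' - 1) + real k' * (real k' - 1) * (real k' - 2)"
            using A(1) by (auto intro!: add_nonneg_nonneg mult_nonneg_nonneg)
          moreover have "c - p - 4 / 3 * q \<le> c" if "0 \<le> p" "0 \<le> q" for c p q :: real
            using that by simp
          ultimately show ?thesis by blast
        qed
        finally show ?thesis using mono by linarith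
      qed (use e B k' in auto)
    qed
    then have "\<theta> * ip (Sym n) f f \<le> b m k * ip (Sym n) f f"
      by (intro mult_right_mono ip_self_nonneg)
    with max show ?thesis by (simp add: b_def)
  qed
qed

section \<open>Spectral expansion of the heat kernel\<close>

lemma no_inv_mono:
  assumes "k \<le> l"
  shows "no_inv n {1..n} k \<subseteq> no_inv n {1..n} l"
  using assms by (rule lift_Suc_mono_le[rotated]) (rule no_inv_Suc, simp)

text \<open>The basis of each level is extended to the next one. The old vectors are complete for
  the lower level and the new ones are orthogonal to them, hence to that whole level. This last
  property permits counting basis vectors level by level.\<close>

lemma adapted_eigenbasis_upto:
  assumes "n \<ge> 1"
  shows "\<exists>E. finite E \<and> orthonormal (Sym n) E \<and> E \<subseteq> no_inv n {1..n} (Suc m) \<and>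
    (\<forall>e\<in>E. \<exists>\<theta>. cyc4_sum {1..n} e = (\<lambda>x. \<theta> * e x)) \<and>
    (\<forall>f\<in>no_inv n {1..n} (Suc m). (\<forall>e\<in>E. ip (Sym n) f e = 0) \<longrightarrow> f = (\<lambda>_. 0)) \<and>
    (\<forall>e\<in>E. \<forall>k. e \<notin> no_inv n {1..n} k \<longrightarrow> (\<forall>f\<in>no_inv n {1..n} k. ip (Sym n) e f = 0))"
proof (induction m)
  case 0
  have "f = (\<lambda>_. 0)" if "f \<in> no_inv n {1..n} (Suc 0)" for f
    using no_inv_one[of f n "{1..n}"] that assms by simp
  then show ?case by (intro exI[of _ "{}"]) (auto simp: orthonormal_def)
next
  case (Suc m)
  then obtain E where E: "finite E" "orthonormal (Sym n) E" "E \<subseteq> no_inv n {1..n} (Suc m)"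
    "\<And>e. e \<in> E \<Longrightarrow> \<exists>\<theta>. cyc4_sum {1..n} e = (\<lambda>x. \<theta> * e x)"
    "\<And>f. f \<in> no_inv n {1..n} (Suc m) \<Longrightarrow> (\<forall>e\<in>E. ip (Sym n) f e = 0) \<Longrightarrow> f = (\<lambda>_. 0)"
    "\<And>e k f. e \<in> E \<Longrightarrow> e \<notin> no_inv n {1..n} k \<Longrightarrow> f \<in> no_inv n {1..n} k \<Longrightarrow> ip (Sym n) e f = 0"
    by blast
  have ann: "no_inv n {1..n} k = annihilator (Sym n) (coset_indicators n {1..n} k)" for k
    by (rule no_inv_eq_annihilator) simp
  have inv: "cyc4_sum {1..n} f \<in> annihilator (Sym n) (coset_indicators n {1..n} (Suc (Suc m)))"
    if "f \<in> annihilator (Sym n) (coset_indicators n {1..n} (Suc (Suc m)))" for f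
    using cyc4_sum_in_no_inv[of f n "{1..n}"] that unfolding ann by simp
  have sub: "E \<subseteq> annihilator (Sym n) (coset_indicators n {1..n} (Suc (Suc m)))"
    using E(3) no_inv_mono[of "Suc m" "Suc (Suc m)" n] unfolding ann by auto
  obtain E' where E': "finite E'" "E \<subseteq> E'" "orthonormal (Sym n) E'" "E' \<subseteq> no_inv n {1..n} (Suc (Suc m))"
    "\<And>e. e \<in> E' \<Longrightarrow> \<exists>\<theta>. cyc4_sum {1..n} e = (\<lambda>x. \<theta> * e x)"
    "\<And>f. f \<in> no_inv n {1..n} (Suc (Suc m)) \<Longrightarrow> (\<forall>e\<in>E'. ip (Sym n) f e = 0) \<Longrightarrow> f = (\<lambda>_. 0)"
    unfolding ann
    using orthonormal_eigenbasis_extend[where Q = "cyc4_sum {1..n}", OF finite_Sym cyc4_sum_linear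
        cyc4_sum_continuous cyc4_sum_symmetric[OF order_refl] inv E(1,2) sub E(4)] by metis
  have "ip (Sym n) e f = 0" if e: "e \<in> E'" "e \<notin> no_inv n {1..n} k" and f: "f \<in> no_inv n {1..n} k" for e k f
  proof (cases "e \<in> E")
    case True
    then show ?thesis using E(6) e f by blast
  next
    case False
    have "k \<le> Suc m"
    proof (rule ccontr)
      assume "\<not> k \<le> Suc m"
      then have "Suc (Suc m) \<le> k" by simp
      then show False using no_inv_mono[of "Suc (Suc m)" k n] e E'(4) by blast
    qed
    then have "f \<in> no_inv n {1..n} (Suc m)" using f no_inv_mono by blast
    then have "ip (Sym n) f e = (\<Sum>d\<in>E. ip (Sym n) f d * ip (Sym n) d e)"
      unfolding ann by (rule complete_orthonormal_parseval[OF E(1,2) _ E(3,5)[unfolded ann]])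
    also have "\<dots> = 0"
    proof (rule sum.neutral, rule ballI)
      fix d assume d: "d \<in> E"
      then have "d \<in> E'" "d \<noteq> e" using E'(2) False by auto
      then have "ip (Sym n) d e = 0" using E'(3) e(1) unfolding orthonormal_def by blast
      then show "ip (Sym n) f d * ip (Sym n) d e = 0" by simp
    qed
    finally show ?thesis by (simp add: ip_commute)
  qed
  then show ?case using E' by (intro exI[of _ E']) blast
qed

lemma adapted_eigenbasis:
  assumes "n \<ge> 1"
  obtains E \<theta> where "finite E" "orthonormal (Sym n) E"
    "\<And>e. e \<in> E \<Longrightarrow> cyc4_sum {1..n} e = (\<lambda>x. \<theta> e * e x)"
    "\<And>f. (\<And>x. x \<notin> Sym n \<Longrightarrow> f x = 0) \<Longrightarrow> ip (Sym n) f f = (\<Sum>e\<in>E. (ip (Sym n) f e)\<^sup>2)"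
    "\<And>e k f. e \<in> E \<Longrightarrow> e \<notin> no_inv n {1..n} k \<Longrightarrow> f \<in> no_inv n {1..n} k \<Longrightarrow> ip (Sym n) e f = 0"
proof -
  \<comment> \<open>No subset has \<open>n + 1\<close> elements, so at the top only the support
    condition remains.\<close>
  have all: "f \<in> no_inv n {1..n} (Suc n)" if "\<And>x. x \<notin> Sym n \<Longrightarrow> f x = 0" for f
  proof -
    have "card A \<noteq> Suc n" if "A \<subseteq> {1..n}" for A using card_mono[OF _ that] by simp
    then show ?thesis using that by (auto simp: no_inv_def)
  qed
  have ann: "no_inv n {1..n} k = annihilator (Sym n) (coset_indicators n {1..n} k)" for k
    by (rule no_inv_eq_annihilator) simp
  obtain E where E: "finite E" "orthonormal (Sym n) E" "E \<subseteq> no_inv n {1..n} (Suc n)"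
    "\<And>e. e \<in> E \<Longrightarrow> \<exists>\<theta>. cyc4_sum {1..n} e = (\<lambda>x. \<theta> * e x)"
    "\<And>f. f \<in> no_inv n {1..n} (Suc n) \<Longrightarrow> (\<forall>e\<in>E. ip (Sym n) f e = 0) \<Longrightarrow> f = (\<lambda>_. 0)"
    "\<And>e k f. e \<in> E \<Longrightarrow> e \<notin> no_inv n {1..n} k \<Longrightarrow> f \<in> no_inv n {1..n} k \<Longrightarrow> ip (Sym n) e f = 0"
    using adapted_eigenbasis_upto[OF assms, of n] by blast
  obtain \<theta> where \<theta>: "\<And>e. e \<in> E \<Longrightarrow> cyc4_sum {1..n} e = (\<lambda>x. \<theta> e * e x)"
    using E(4) by metis
  have parseval: "ip (Sym n) f f = (\<Sum>e\<in>E. (ip (Sym n) f e)\<^sup>2)" if "\<And>x. x \<notin> Sym n \<Longrightarrow> f x = 0" for f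
  proof -
    have "f \<in> no_inv n {1..n} (Suc n)" by (rule all) (rule that)
    then have "ip (Sym n) f f = (\<Sum>e\<in>E. ip (Sym n) f e * ip (Sym n) e f)"
      unfolding ann by (rule complete_orthonormal_parseval[OF E(1,2) _ E(3,5)[unfolded ann]])
    also have "\<dots> = (\<Sum>e\<in>E. (ip (Sym n) f e)\<^sup>2)"
      by (intro sum.cong refl) (metis ip_commute power2_eq_square)
    finally show ?thesis .
  qed
  show thesis by (rule that[OF E(1,2) \<theta> parseval E(6)])
qed

section \<open>The class of 4-cycles and its convolution powers\<close>

lemma cyc4_apply:
  assumes "distinct [a, b, c, d]"
  shows "cyc4 (a, b, c, d) a = b" "cyc4 (a, b, c, d) b = c" "cyc4 (a, b, c, d) c = d" "cyc4 (a, b, c, d) d = a"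
    "x \<notin> {a, b, c, d} \<Longrightarrow> cyc4 (a, b, c, d) x = x"
  using assms by (auto simp: Transposition.transpose_def)

lemma four_cycles_eq: "four_cycles n = cyc4 ` tuples4 {1..n} {1..n} {1..n} {1..n}"
proof -
  have eq: "cycle_of_list [a, b, c, d] = cyc4 (a, b, c, d)" for a b c d :: nat
    by (simp add: comp_assoc)
  have "tuples4 {1..n} {1..n} {1..n} {1..n} =
      {(a, b, c, d) | a b c d. distinct [a, b, c, d] \<and> set [a, b, c, d] \<subseteq> {1..n}}"
    by (auto simp: tuples4_def)
  then show ?thesis unfolding four_cycles_def eq by (simp only:) blast
qed

text \<open>A tuple is determined by its cycle and its first entry, which may be any of the four
  moved points.\<close>

lemma cyc4_fibre:
  assumes "z \<in> tuples4 B B B B"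
  shows "card {w \<in> tuples4 B B B B. cyc4 w = cyc4 z} = 4"
proof -
  obtain a b c d where z: "z = (a, b, c, d)" by (cases z)
  have dist: "distinct [a, b, c, d]" and B: "a \<in> B" "b \<in> B" "c \<in> B" "d \<in> B"
    using assms by (auto simp: z tuples4_def)
  note ap = cyc4_apply[OF dist]
  have "{w \<in> tuples4 B B B B. cyc4 w = cyc4 z} = {(a, b, c, d), (b, c, d, a), (c, d, a, b), (d, a, b, c)}" (is "?L = ?R")
  proof
    show "?L \<subseteq> ?R"
    proof
      fix w assume w: "w \<in> ?L"
      obtain p q r s where pqrs: "w = (p, q, r, s)" by (cases w)
      have d': "distinct [p, q, r, s]" using w by (auto simp: pqrs tuples4_def)
      have e: "cyc4 (p, q, r, s) = cyc4 (a, b, c, d)" using w by (simp only: pqrs z mem_Collect_eq)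
      note ap' = cyc4_apply[OF d', unfolded e]
      have "p \<in> {a, b, c, d}"
      proof (rule ccontr)
        assume "p \<notin> {a, b, c, d}"
        then have "cyc4 (a, b, c, d) p = p" by (rule ap(5))
        then show False using ap'(1) d' by (simp del: cyc4.simps)
      qed
      then consider "p = a" | "p = b" | "p = c" | "p = d" by blast
      then show "w \<in> ?R"
        by cases (use ap(1-4) ap'(1-4) in \<open>simp_all del: cyc4.simps add: pqrs\<close>)
    qed
    have "(b, c, d, a) \<in> ?L" "(c, d, a, b) \<in> ?L" "(d, a, b, c) \<in> ?L"
      using assms z dist B cyc4_rotate[of a b c d B B B B] cyc4_rotate[of b c d a B B B B] cyc4_rotate[of c d a b B B B B]
      by (auto simp del: cyc4.simps simp: tuples4_def)
    then show "?R \<subseteq> ?L" using assms z by (simp del: cyc4.simps)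
  qed
  then show ?thesis using dist by simp
qed

lemma sum_cyc4_eq:
  fixes g :: "(nat \<Rightarrow> nat) \<Rightarrow> real"
  shows "(\<Sum>z\<in>tuples4 {1..n} {1..n} {1..n} {1..n}. g (cyc4 z)) = 4 * (\<Sum>\<sigma>\<in>four_cycles n. g \<sigma>)"
proof -
  let ?T = "tuples4 {1..n} {1..n} {1..n} {1..n}"
  have "(\<Sum>z\<in>?T. g (cyc4 z)) = (\<Sum>\<sigma>\<in>cyc4 ` ?T. \<Sum>z\<in>{z \<in> ?T. cyc4 z = \<sigma>}. g (cyc4 z))"
    by (rule sum.image_gen) (simp add: finite_tuples4)
  also have "\<dots> = (\<Sum>\<sigma>\<in>cyc4 ` ?T. 4 * g \<sigma>)"
  proof (rule sum.cong[OF refl])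
    fix \<sigma> assume "\<sigma> \<in> cyc4 ` ?T"
    then obtain w where w: "w \<in> ?T" "\<sigma> = cyc4 w" by blast
    have "(\<Sum>z\<in>{z \<in> ?T. cyc4 z = \<sigma>}. g (cyc4 z)) = (\<Sum>z\<in>{z \<in> ?T. cyc4 z = \<sigma>}. g \<sigma>)"
      by (rule sum.cong) auto
    also have "\<dots> = 4 * g \<sigma>" using cyc4_fibre[OF w(1)] w(2) by simp
    finally show "(\<Sum>z\<in>{z \<in> ?T. cyc4 z = \<sigma>}. g (cyc4 z)) = 4 * g \<sigma>" .
  qed
  finally show ?thesis by (simp add: four_cycles_eq sum_distrib_left)
qed

lemma sum_q_c4:
  assumes "n \<ge> 4"
  shows "(\<Sum>\<sigma>\<in>Sym n. q_c4 n \<sigma> * g \<sigma>) =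
    (\<Sum>z\<in>tuples4 {1..n} {1..n} {1..n} {1..n}. g (cyc4 z)) / (real n * (real n - 1) * (real n - 2) * (real n - 3))"
proof -
  let ?T = "tuples4 {1..n} {1..n} {1..n} {1..n}"
  define N where "N = real n * (real n - 1) * (real n - 2) * (real n - 3)"
  have "real (card ?T) = N" unfolding N_def by (rule card_tuples4) auto
  then have N: "N = 4 * real (card (four_cycles n))" using sum_cyc4_eq[of "\<lambda>_. 1" n] by simp
  have "N > 0" using assms by (simp add: N_def)
  have sub: "four_cycles n \<subseteq> Sym n" unfolding four_cycles_eq using cyc4_permutes by (auto simp: Sym_def simp del: cyc4.simps)
  have "(\<Sum>\<sigma>\<in>Sym n. q_c4 n \<sigma> * g \<sigma>) = (\<Sum>\<sigma>\<in>four_cycles n. q_c4 n \<sigma> * g \<sigma>)"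
    using sub finite_Sym by (intro sum.mono_neutral_right) (auto simp: q_c4_def)
  also have "\<dots> = (\<Sum>\<sigma>\<in>four_cycles n. g \<sigma>) / real (card (four_cycles n))"
    by (simp add: q_c4_def sum_divide_distrib)
  also have "\<dots> = (\<Sum>z\<in>?T. g (cyc4 z)) / N"
    unfolding sum_cyc4_eq N by simp
  finally show ?thesis by (simp add: N_def)
qed

lemma Sym_comp_left_iff:
  assumes "y \<in> Sym n"
  shows "y \<circ> x \<in> Sym n \<longleftrightarrow> x \<in> Sym n" "inv y \<circ> x \<in> Sym n \<longleftrightarrow> x \<in> Sym n"
    "inv y \<circ> (y \<circ> x) = x" "y \<circ> (inv y \<circ> x) = x"
proof -
  have y: "y permutes {1..n}" using assms by (simp add: Sym_def)
  show eq: "inv y \<circ> (y \<circ> x) = x" "y \<circ> (inv y \<circ> x) = x" for x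
    using permutes_inv_o[OF y] by (simp_all add: comp_assoc[symmetric])
  have *: "x \<in> Sym n \<Longrightarrow> y \<circ> x \<in> Sym n" "x \<in> Sym n \<Longrightarrow> inv y \<circ> x \<in> Sym n" for x
    using permutes_compose[OF _ y] permutes_compose[OF _ permutes_inv[OF y]] by (auto simp: Sym_def)
  show "y \<circ> x \<in> Sym n \<longleftrightarrow> x \<in> Sym n" "inv y \<circ> x \<in> Sym n \<longleftrightarrow> x \<in> Sym n"
    using * eq by metis+
qed

lemma sum_Sym_translate:
  assumes "y \<in> Sym n"
  shows "(\<Sum>x\<in>Sym n. F (inv y \<circ> x) x) = (\<Sum>x\<in>Sym n. F x (y \<circ> x))"
  by (rule sum.reindex_bij_witness[where i = "\<lambda>x. y \<circ> x" and j = "\<lambda>x. inv y \<circ> x"])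
    (simp_all add: Sym_comp_left_iff[OF assms])

text \<open>Pairing with \<open>f\<close> moves the last convolution factor onto \<open>f\<close>,
  where it acts as the normalised 4-cycle sum; the zeroth power is the point mass at the
  identity.\<close>

lemma conv_pow_eigen:
  fixes f :: "(nat \<Rightarrow> nat) \<Rightarrow> real"
  assumes n: "n \<ge> 4" and f: "cyc4_sum {1..n} f = (\<lambda>x. \<theta> * f x)"
  shows "(\<Sum>x\<in>Sym n. conv_pow n (q_c4 n) k x * f x) =
    (\<theta> / (real n * (real n - 1) * (real n - 2) * (real n - 3))) ^ k * f (id :: nat \<Rightarrow> nat)"
proof (induction k)
  case 0
  have "id \<in> Sym n" by (simp add: Sym_def permutes_id)
  then show ?case using finite_Sym by (simp add: if_distrib[of "\<lambda>c. c * _"] id_def cong: if_cong)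
next
  case (Suc k)
  define N where "N = real n * (real n - 1) * (real n - 2) * (real n - 3)"
  let ?p = "conv_pow n (q_c4 n) k"
  have "(\<Sum>x\<in>Sym n. conv_pow n (q_c4 n) (Suc k) x * f x) = (\<Sum>x\<in>Sym n. \<Sum>y\<in>Sym n. ?p y * q_c4 n (inv y \<circ> x) * f x)"
    by (simp add: conv_def sum_distrib_right)
  also have "\<dots> = (\<Sum>y\<in>Sym n. \<Sum>x\<in>Sym n. ?p y * q_c4 n (inv y \<circ> x) * f x)" by (rule sum.swap)
  also have "\<dots> = (\<Sum>y\<in>Sym n. ?p y * (\<theta> / N * f y))"
  proof (rule sum.cong[OF refl])
    fix y assume y: "y \<in> Sym n"
    have "(\<Sum>x\<in>Sym n. ?p y * q_c4 n (inv y \<circ> x) * f x) = ?p y * (\<Sum>x\<in>Sym n. q_c4 n (inv y \<circ> x) * f x)"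
      by (simp add: sum_distrib_left mult.assoc)
    also have "(\<Sum>x\<in>Sym n. q_c4 n (inv y \<circ> x) * f x) = (\<Sum>\<sigma>\<in>Sym n. q_c4 n \<sigma> * f (y \<circ> \<sigma>))"
      by (rule sum_Sym_translate[OF y])
    also have "\<dots> = cyc4_sum {1..n} f y / N" using sum_q_c4[OF n] by (simp add: cyc4_sum_def N_def)
    also have "\<dots> = \<theta> / N * f y" by (simp only: f) simp
    finally show "(\<Sum>x\<in>Sym n. ?p y * q_c4 n (inv y \<circ> x) * f x) = ?p y * (\<theta> / N * f y)" .
  qed
  also have "\<dots> = \<theta> / N * (\<Sum>y\<in>Sym n. ?p y * f y)" by (simp add: sum_distrib_left algebra_simps)
  finally show ?case using Suc.IH by (simp add: N_def)
qed

text \<open>A crude bound, enough to compare the heat series with an exponential series.\<close>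

lemma conv_pow_bound: "\<bar>conv_pow n (q_c4 n) k x\<bar> \<le> fact n ^ k"
proof (induction k arbitrary: x)
  case (Suc k)
  have q: "\<bar>q_c4 n y\<bar> \<le> 1" for y
  proof (cases "card (four_cycles n) = 0")
    case False
    then have "1 \<le> card (four_cycles n)" by linarith
    then show ?thesis by (simp add: q_c4_def)
  qed (simp add: q_c4_def)
  have "\<bar>conv_pow n (q_c4 n) (Suc k) x\<bar> \<le> (\<Sum>y\<in>Sym n. \<bar>conv_pow n (q_c4 n) k y * q_c4 n (inv y \<circ> x)\<bar>)"
    by (simp add: conv_def)
  also have "\<dots> \<le> (\<Sum>y\<in>Sym n. fact n ^ k * 1)"
    unfolding abs_mult by (intro sum_mono mult_mono Suc.IH q) auto
  finally show ?case by (simp add: card_Sym)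
qed simp

lemma summable_heat: "summable (\<lambda>k. t ^ k / fact k * conv_pow n (q_c4 n) k x)"
proof (rule summable_comparison_test')
  show "summable (\<lambda>k. (\<bar>t\<bar> * fact n) ^ k /\<^sub>R fact k)" by (rule summable_exp_generic)
  show "norm (t ^ k / fact k * conv_pow n (q_c4 n) k x) \<le> (\<bar>t\<bar> * fact n) ^ k /\<^sub>R fact k" for k
    using mult_left_mono[OF conv_pow_bound[of n k x], of "\<bar>t\<bar> ^ k / fact k"]
    by (simp add: abs_mult power_abs power_mult_distrib field_simps)
qed

lemma heat_eigen:
  fixes f :: "(nat \<Rightarrow> nat) \<Rightarrow> real"
  assumes n: "n \<ge> 4" and f: "cyc4_sum {1..n} f = (\<lambda>x. \<theta> * f x)"
  shows "(\<Sum>x\<in>Sym n. heat_c4 n t x * f x) =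
    exp (- t * (1 - \<theta> / (real n * (real n - 1) * (real n - 2) * (real n - 3)))) * f (id :: nat \<Rightarrow> nat)"
proof -
  define r where "r = \<theta> / (real n * (real n - 1) * (real n - 2) * (real n - 3))"
  define a where "a k x = t ^ k / fact k * conv_pow n (q_c4 n) k x" for k x
  have "(\<lambda>k. \<Sum>x\<in>Sym n. a k x * f x) sums (\<Sum>x\<in>Sym n. suminf (\<lambda>k. a k x) * f x)"
    unfolding a_def by (intro sums_sum sums_mult2 summable_sums summable_heat)
  moreover have "(\<Sum>x\<in>Sym n. a k x * f x) = ((t * r) ^ k /\<^sub>R fact k) * f id" for k
  proof -
    have "(\<Sum>x\<in>Sym n. a k x * f x) = t ^ k / fact k * (\<Sum>x\<in>Sym n. conv_pow n (q_c4 n) k x * f x)"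
      by (simp add: a_def sum_distrib_left mult.assoc)
    then show ?thesis unfolding conv_pow_eigen[OF n f] by (simp add: r_def power_mult_distrib field_simps)
  qed
  ultimately have "(\<lambda>k. ((t * r) ^ k /\<^sub>R fact k) * f id) sums (\<Sum>x\<in>Sym n. suminf (\<lambda>k. a k x) * f x)"
    by simp
  moreover have "(\<lambda>k. ((t * r) ^ k /\<^sub>R fact k) * f id) sums (exp (t * r) * f id)"
    by (intro sums_mult2 exp_converges)
  ultimately have eq: "(\<Sum>x\<in>Sym n. suminf (\<lambda>k. a k x) * f x) = exp (t * r) * f id" by (rule sums_unique2)
  have "(\<Sum>x\<in>Sym n. heat_c4 n t x * f x) = exp (- t) * (\<Sum>x\<in>Sym n. suminf (\<lambda>k. a k x) * f x)"
    by (simp add: heat_c4_def a_def sum_distrib_left mult.assoc)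
  also have "\<dots> = exp (- t) * exp (t * r) * f id" by (simp add: eq)
  also have "exp (- t) * exp (t * r) = exp (- t * (1 - r))" by (simp add: exp_add[symmetric] algebra_simps)
  finally show ?thesis by (simp add: r_def id_def)
qed

lemma cyc4_sum_left_translate:
  assumes "cyc4_sum B f = (\<lambda>x. \<theta> * f x)"
  shows "cyc4_sum B (\<lambda>x. f (y \<circ> x)) = (\<lambda>x. \<theta> * f (y \<circ> x))"
proof
  fix x
  have "cyc4_sum B (\<lambda>x. f (y \<circ> x)) x = cyc4_sum B f (y \<circ> x)" by (simp add: cyc4_sum_def comp_assoc)
  then show "cyc4_sum B (\<lambda>x. f (y \<circ> x)) x = \<theta> * f (y \<circ> x)" by (simp add: assms)
qed

text \<open>By left invariance of the distance, the starting point of the walk may be averaged over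
  the group, which turns the values \<open>e y\<close> of the eigenfunctions into their norms.\<close>

lemma d2_heat_sq:
  assumes n: "n \<ge> 4" and E: "finite E" "orthonormal (Sym n) E"
    "\<And>e. e \<in> E \<Longrightarrow> cyc4_sum {1..n} e = (\<lambda>x. \<theta> e * e x)"
    "\<And>f. (\<And>x. x \<notin> Sym n \<Longrightarrow> f x = 0) \<Longrightarrow> ip (Sym n) f f = (\<Sum>e\<in>E. (ip (Sym n) f e)\<^sup>2)"
    "\<And>e k f. e \<in> E \<Longrightarrow> e \<notin> no_inv n {1..n} k \<Longrightarrow> f \<in> no_inv n {1..n} k \<Longrightarrow> ip (Sym n) e f = 0"
  shows "(d2 n (heat_c4 n t) (unif n))\<^sup>2 = (\<Sum>e\<in>{e \<in> E. e \<in> no_inv n {1..n} n}.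
    exp (- 2 * t * (1 - \<theta> e / (real n * (real n - 1) * (real n - 2) * (real n - 3)))))"
proof -
  define N where "N = real n * (real n - 1) * (real n - 2) * (real n - 3)"
  let ?h = "heat_c4 n t" and ?u = "unif n"
  have N0: "N > 0" using n by (simp add: N_def)
  have const: "cyc4_sum {1..n} (\<lambda>_. 1) = (\<lambda>x. N * 1)"
    using card_tuples4[of "{1..n}" n] by (simp add: fun_eq_iff cyc4_sum_def N_def)
  have h1: "(\<Sum>x\<in>Sym n. ?h x) = 1"
    using heat_eigen[OF n const, of t, folded N_def] N0 by simp
  have u1: "(\<Sum>x\<in>Sym n. ?u x) = 1"
    by (simp add: unif_def card_Sym)
  \<comment> \<open>The only subset with \<open>n\<close> elements is the whole set, so level
    \<open>n\<close> is the space of functions of mean zero: restricting to it discards the trivial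
    eigenvalue.\<close>
  have mean: "f \<in> no_inv n {1..n} n \<longleftrightarrow> (\<Sum>x\<in>Sym n. f x) = 0" if f: "\<And>x. x \<notin> Sym n \<Longrightarrow> f x = 0" for f
  proof -
    have A: "A = {1..n}" if "A \<subseteq> {1..n}" "card A = n" for A using card_subset_eq[OF _ that(1)] that(2) by simp
    have s: "sym_sum {1..n} f x = (\<Sum>x\<in>Sym n. f x)" if x: "x \<in> Sym n" for x
      using setum_permutations_compose_left[of x "{1..n}" f] x by (simp add: sym_sum_def Sym_def)
    have "id \<in> Sym n" by (simp add: Sym_def permutes_id)
    show ?thesis
    proof
      assume "f \<in> no_inv n {1..n} n"
      then have "sym_sum {1..n} f id = 0" using \<open>id \<in> Sym n\<close> by (simp add: no_inv_def)
      then show "(\<Sum>x\<in>Sym n. f x) = 0" using s[OF \<open>id \<in> Sym n\<close>] by simp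
    next
      assume z: "(\<Sum>x\<in>Sym n. f x) = 0"
      have "sym_sum A f x = 0" if "A \<subseteq> {1..n}" "card A = n" "x \<in> Sym n" for A x
        using s[OF that(3)] z unfolding A[OF that(1,2)] by simp
      then show "f \<in> no_inv n {1..n} n" using f by (simp add: no_inv_def)
    qed
  qed
  \<comment> \<open>The deviation from uniformity for the walk started at \<open>y\<close>.\<close>
  define g where "g y = (\<lambda>x. if x \<in> Sym n then ?h (inv y \<circ> x) - ?u x else 0)" for y
  have gg: "ip (Sym n) (g y) (g y) = (\<Sum>x\<in>Sym n. \<bar>?h x - ?u x\<bar>\<^sup>2)" if y: "y \<in> Sym n" for y
  proof -
    have "ip (Sym n) (g y) (g y) = (\<Sum>x\<in>Sym n. (?h (inv y \<circ> x) - ?u x)\<^sup>2)"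
      by (simp add: ip_def g_def power2_eq_square)
    also have "\<dots> = (\<Sum>x\<in>Sym n. (?h x - ?u (y \<circ> x))\<^sup>2)"
      by (rule sum_Sym_translate[OF y, of "\<lambda>a b. (?h a - ?u b)\<^sup>2"])
    also have "\<dots> = (\<Sum>x\<in>Sym n. \<bar>?h x - ?u x\<bar>\<^sup>2)"
      by (intro sum.cong refl) (simp add: unif_def Sym_comp_left_iff[OF y])
    finally show ?thesis .
  qed
  have g_mean: "g y \<in> no_inv n {1..n} n" if y: "y \<in> Sym n" for y
  proof -
    have "(\<Sum>x\<in>Sym n. g y x) = (\<Sum>x\<in>Sym n. ?h (inv y \<circ> x)) - (\<Sum>x\<in>Sym n. ?u x)"
      by (simp add: g_def sum_subtractf)
    also have "(\<Sum>x\<in>Sym n. ?h (inv y \<circ> x)) = (\<Sum>x\<in>Sym n. ?h x)"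
      by (rule sum_Sym_translate[OF y, of "\<lambda>a b. ?h a"])
    finally show ?thesis using mean[of "g y"] h1 u1 by (simp add: g_def)
  qed
  have ge: "ip (Sym n) (g y) e = (if e \<in> no_inv n {1..n} n then exp (- t * (1 - \<theta> e / N)) * e y else 0)"
    if y: "y \<in> Sym n" and e: "e \<in> E" for y e
  proof (cases "e \<in> no_inv n {1..n} n")
    case False
    then show ?thesis using E(5)[OF e False g_mean[OF y]] by (simp add: ip_commute)
  next
    case True
    have supp: "\<And>x. x \<notin> Sym n \<Longrightarrow> e x = 0" using E(2) e by (simp add: orthonormal_def)
    have "(\<Sum>x\<in>Sym n. ?u x * e x) = (\<Sum>x\<in>Sym n. e x) / real (card (Sym n))"
      by (simp add: unif_def sum_divide_distrib)
    also have "\<dots> = 0" using mean[OF supp] True by simp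
    finally have ue: "(\<Sum>x\<in>Sym n. ?u x * e x) = 0" .
    have "ip (Sym n) (g y) e = (\<Sum>x\<in>Sym n. ?h (inv y \<circ> x) * e x) - (\<Sum>x\<in>Sym n. ?u x * e x)"
      by (simp add: ip_def g_def left_diff_distrib sum_subtractf)
    also have "(\<Sum>x\<in>Sym n. ?h (inv y \<circ> x) * e x) = (\<Sum>x\<in>Sym n. ?h x * e (y \<circ> x))"
      by (rule sum_Sym_translate[OF y, of "\<lambda>a b. ?h a * e b"])
    also have "\<dots> = exp (- t * (1 - \<theta> e / N)) * e y"
      using heat_eigen[OF n cyc4_sum_left_translate[OF E(3)[OF e]], of t y] by (simp add: N_def)
    finally show ?thesis using True ue by simp
  qed
  let ?E = "{e \<in> E. e \<in> no_inv n {1..n} n}"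
  have "(d2 n ?h ?u)\<^sup>2 = real (card (Sym n)) * (\<Sum>x\<in>Sym n. \<bar>?h x - ?u x\<bar>\<^sup>2)"
    unfolding d2_def by (intro real_sqrt_pow2 mult_nonneg_nonneg sum_nonneg) auto
  also have "\<dots> = (\<Sum>y\<in>Sym n. ip (Sym n) (g y) (g y))" by (simp add: gg)
  also have "\<dots> = (\<Sum>y\<in>Sym n. \<Sum>e\<in>E. (ip (Sym n) (g y) e)\<^sup>2)"
    by (intro sum.cong refl E(4)) (simp add: g_def)
  also have "\<dots> = (\<Sum>y\<in>Sym n. \<Sum>e\<in>?E. exp (- 2 * t * (1 - \<theta> e / N)) * (e y)\<^sup>2)"
  proof (rule sum.cong[OF refl])
    fix y assume y: "y \<in> Sym n"
    have "(\<Sum>e\<in>E. (ip (Sym n) (g y) e)\<^sup>2) = (\<Sum>e\<in>?E. (ip (Sym n) (g y) e)\<^sup>2)"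
      using E(1) y by (intro sum.mono_neutral_right) (auto simp: ge)
    also have "\<dots> = (\<Sum>e\<in>?E. exp (- 2 * t * (1 - \<theta> e / N)) * (e y)\<^sup>2)"
      using y by (intro sum.cong refl) (simp add: ge power_mult_distrib exp_double[symmetric] algebra_simps)
    finally show "(\<Sum>e\<in>E. (ip (Sym n) (g y) e)\<^sup>2) = (\<Sum>e\<in>?E. exp (- 2 * t * (1 - \<theta> e / N)) * (e y)\<^sup>2)" .
  qed
  also have "\<dots> = (\<Sum>e\<in>?E. exp (- 2 * t * (1 - \<theta> e / N)) * (\<Sum>y\<in>Sym n. (e y)\<^sup>2))"
    by (subst sum.swap) (simp add: sum_distrib_left)
  also have "\<dots> = (\<Sum>e\<in>?E. exp (- 2 * t * (1 - \<theta> e / N)))"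
    using E(2) by (intro sum.cong refl) (simp add: orthonormal_def ip_def power2_eq_square)
  finally show ?thesis by (simp add: N_def)
qed

section \<open>Bounding the expansion\<close>

text \<open>An upper bound for the normalised eigenvalue at level \<open>k\<close>. With
  \<open>j = n - k\<close> the threshold \<open>3 * j < n\<close> is \<open>2 * j < k\<close>, the
  range in which a single peeling step gives \<open>1 - 2 * j / n\<close>. The correction
  \<open>4 / (3 * (n - 3))\<close> is the second summand of \<open>cyc4_sum_le\<close> divided by
  the number of tuples.\<close>

definition rate :: "nat \<Rightarrow> nat \<Rightarrow> real" where
  "rate n k = (if 3 * (n - k) < n then 1 - 2 * real (n - k) / real n
     else (real k / real n) ^ 3 + 4 / (3 * (real n - 3)))"

text \<open>After the substitution \<open>j = x + 1\<close>, \<open>k = 2 * x + y + 3\<close>, which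
  parametrises the admissible range by \<open>x, y \<ge> 0\<close>, the difference of the two sides
  has non-negative coefficients only.\<close>

lemma peel_polynomial_le:
  fixes j k :: nat
  assumes "j \<ge> 1" "2 * j < k"
  defines "n \<equiv> real j + real k"
  shows "real k * (real k - 1) * (real k - 2) * (real k - 3) - 4 * real j * (real k - 1) * (real k - 2)
      + 4 * real k * real j * (real j - 1) + real j * (real j - 1) * (real j - 2) * (real j - 3)
    \<le> (n - 1) * (n - 2) * (n - 3) * (n - 2 * real j)"
proof -
  obtain i where i: "j = Suc i" using assms(1) by (cases j) auto
  obtain s where s: "k = Suc (2 * j) + s" using assms(2) by (metis less_iff_Suc_add add_Suc)
  define x y where "x = real i" and "y = real s"
  have xy: "x \<ge> 0" "y \<ge> 0" by (simp_all add: x_def y_def)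
  have j: "real j = x + 1" and k: "real k = 2 * x + y + 3" by (simp_all add: i s x_def y_def)
  have "(n - 1) * (n - 2) * (n - 3) * (n - 2 * real j)
      - (real k * (real k - 1) * (real k - 2) * (real k - 3) - 4 * real j * (real k - 1) * (real k - 2)
      + 4 * real k * real j * (real j - 1) + real j * (real j - 1) * (real j - 2) * (real j - 3))
    = 20 + 34 * y + 16 * y^2 + 2 * y^3 + 78 * x + 96 * x * y + 28 * x * y^2 + 2 * x * y^3
      + 118 * x^2 + 84 * x^2 * y + 12 * x^2 * y^2 + 70 * x^3 + 22 * x^3 * y + 10 * x^4"
    unfolding n_def j k by (simp add: algebra_simps power2_eq_square power3_eq_cube power4_eq_xxxx)
  moreover have "\<dots> \<ge> 0" using xy by (intro add_nonneg_nonneg) simp_all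
  ultimately show ?thesis by linarith
qed

lemma eigenvalue_le_rate:
  assumes n: "n \<ge> 11" and k: "1 \<le> k" "k < n"
    and e: "e \<in> no_inv n {1..n} (Suc k)" "e \<notin> no_inv n {1..n} k" "cyc4_sum {1..n} e = (\<lambda>x. \<theta> * e x)"
  shows "\<theta> / (real n * (real n - 1) * (real n - 2) * (real n - 3)) \<le> rate n k"
proof -
  define N where "N = real n * (real n - 1) * (real n - 2) * (real n - 3)"
  have N0: "N > 0" using n by (simp add: N_def)
  define j where "j = n - k"
  have nj: "n = j + k" "j \<ge> 1" using k by (simp_all add: j_def)
  have "\<theta> \<le> N * rate n k"
  proof (cases "3 * j < n")
    case True
    then have jk: "2 * j < k" using nj by linarith
    then have k2: "k \<ge> 2" using nj by linarith
    have "\<theta> \<le> (real n - 1) * (real n - 2) * (real n - 3) * (real n - 2 * real j)"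
    proof (rule cyc4_eigenvalue_cases[OF e order_refl k(1)])
      assume "k = 1"
      then show ?thesis using k2 by simp
    next
      fix A v
      assume A: "A \<subseteq> {1..n}" "card A = k" and pos: "ip (Sym n) v v > 0"
        and le: "\<theta> * ip (Sym n) v v \<le>
          (real k * (real k - 1) * (real k - 2) * (real k - 3)
            - 4 * real (card ({1..n} - A)) * (real k - 1) * (real k - 2)
            + 4 * real k * real (card ({1..n} - A)) * (real (card ({1..n} - A)) - 1)) * ip (Sym n) v v
          + ip (Sym n) (cyc4_sum ({1..n} - A) v) v"
      have "finite A" using A(1) by (rule finite_subset) simp
      then have c: "card ({1..n} - A) = j" using A by (simp add: card_Diff_subset j_def)
      \<comment> \<open>The complement has fewer than a third of the points, so counting its tuples
        is affordable.\<close>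
      have "ip (Sym n) (cyc4_sum ({1..n} - A) v) v \<le> real j * (real j - 1) * (real j - 2) * (real j - 3) * ip (Sym n) v v"
        by (rule cyc4_sum_trivial_le[OF _ c]) auto
      with le have "\<theta> * ip (Sym n) v v \<le> (real k * (real k - 1) * (real k - 2) * (real k - 3)
            - 4 * real j * (real k - 1) * (real k - 2) + 4 * real k * real j * (real j - 1)
            + real j * (real j - 1) * (real j - 2) * (real j - 3)) * ip (Sym n) v v"
        unfolding c distrib_right by linarith
      then have "\<theta> \<le> real k * (real k - 1) * (real k - 2) * (real k - 3)
            - 4 * real j * (real k - 1) * (real k - 2) + 4 * real k * real j * (real j - 1)
            + real j * (real j - 1) * (real j - 2) * (real j - 3)"
        using pos by (simp only: mult_le_cancel_right_pos)
      also have "\<dots> \<le> (real n - 1) * (real n - 2) * (real n - 3) * (real n - 2 * real j)"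
        using peel_polynomial_le[OF nj(2) jk] by (simp add: nj)
      finally show ?thesis .
    qed
    also have "\<dots> = N * rate n k"
      using True n by (simp add: N_def rate_def j_def field_simps)
    finally show ?thesis .
  next
    case False
    define K where "K = (real k - 1) * (real k - 2) * (real k - 3)"
    obtain x where x: "x \<in> Sym n" "e x \<noteq> 0"
    proof (rule ccontr)
      assume "\<not> thesis"
      then have "e x = 0" for x using that no_inv_supp[OF e(1)] by blast
      then have "e \<in> no_inv n {1..n} k" by (simp add: no_inv_def sym_sum_def)
      then show False using e(2) by simp
    qed
    have pos: "ip (Sym n) e e > 0" by (rule ip_self_pos[where f = e, OF finite_Sym x])
    have "\<theta> * ip (Sym n) e e \<le> (real n * K + 4 / 3 * (real n * (real n - 1) * (real n - 2))) * ip (Sym n) e e"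
      using cyc4_sum_le[OF order_refl _ k(1) e(1), of n] unfolding e(3) ip_scale_left K_def by simp
    then have "\<theta> \<le> real n * K + 4 / 3 * (real n * (real n - 1) * (real n - 2))"
      using pos by (simp only: mult_le_cancel_right_pos)
    \<comment> \<open>Each ratio \<open>(k - i) / (n - i)\<close> is at most \<open>k / n\<close>;
      for \<open>k\<close> equal to 1 or 2 the product \<open>K\<close> is zero, which avoids
      negative factors.\<close>
    also have "real n * K \<le> N * (real k / real n) ^ 3"
    proof -
      have le: "(real k - i) \<le> (real n - i) * (real k / real n)" if "i \<ge> 0" for i
        using that k n by (simp add: field_simps mult_left_mono)
      have "K \<le> (real n - 1) * (real k / real n) * ((real n - 2) * (real k / real n)) * ((real n - 3) * (real k / real n))"
      proof (cases "k \<ge> 3")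
        case True
        then show ?thesis unfolding K_def using n by (intro mult_mono le mult_nonneg_nonneg) auto
      next
        case False
        then have "k = 1 \<or> k = 2" using k by linarith
        then have "K = 0" by (auto simp: K_def)
        then show ?thesis using n by simp
      qed
      also have "\<dots> = (real n - 1) * (real n - 2) * (real n - 3) * (real k / real n) ^ 3"
        by (simp add: power3_eq_cube)
      finally have "real n * K \<le> real n * ((real n - 1) * (real n - 2) * (real n - 3) * (real k / real n) ^ 3)"
        by (rule mult_left_mono) simp
      then show ?thesis by (simp add: N_def mult.assoc)
    qed
    also have "4 / 3 * (real n * (real n - 1) * (real n - 2)) = N * (4 / (3 * (real n - 3)))"
      using n by (simp add: N_def field_simps)
    finally show ?thesis using False by (simp add: rate_def j_def distrib_left)
  qed
  then show ?thesis using N0 by (simp add: N_def pos_divide_le_eq mult.commute)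
qed

text \<open>Here \<open>k / n\<close> is at most \<open>2 / 3\<close>, whose square is
  \<open>4 / 9\<close>; and \<open>11 / 6\<close> is the value of the decreasing function
  \<open>4 * n / (3 * (n - 3))\<close> at \<open>n = 11\<close>.\<close>

lemma rate_far_le:
  assumes n: "n \<ge> 11" and k: "k < n" "\<not> 3 * (n - k) < n"
  shows "real n * rate n k \<le> 4 / 9 * real k + 11 / 6"
proof -
  have k23: "3 * real k \<le> 2 * real n" using k by linarith
  then have "real k / real n \<le> 2 / 3" using n by (simp add: field_simps)
  then have "(real k / real n)\<^sup>2 \<le> (2 / 3)\<^sup>2" by (intro power_mono) auto
  then have "real k * (real k / real n)\<^sup>2 \<le> real k * (4 / 9)"
    by (intro mult_left_mono) (auto simp: power2_eq_square)
  moreover have "real n * (real k / real n) ^ 3 = real k * (real k / real n)\<^sup>2"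
    using n by (simp add: power3_eq_cube power2_eq_square)
  moreover have "real n * (4 / (3 * (real n - 3))) \<le> 11 / 6"
    using n by (simp add: field_simps)
  ultimately show ?thesis using k by (simp add: rate_def distrib_left)
qed

text \<open>A spectral gap of \<open>2 / n\<close>, attained by the bound at
  \<open>k = n - 1\<close>. It turns the excess \<open>c - 2\<close> into the factor
  \<open>exp (- 2 * (c - 2))\<close>.\<close>

lemma rate_le:
  assumes n: "n \<ge> 11" and k: "k < n"
  shows "real n * rate n k \<le> real n - 2"
proof (cases "3 * (n - k) < n")
  case True
  then have "real n * rate n k = real n - 2 * real (n - k)"
    using n by (simp add: rate_def field_simps)
  moreover have "real (n - k) \<ge> 1" using k by simp
  ultimately show ?thesis by linarith
next
  case False
  then have "3 * real k \<le> 2 * real n" using k by linarith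
  moreover have "real n \<ge> 11" using n by simp
  ultimately show ?thesis using rate_far_le[OF n k False] by linarith
qed

text \<open>The tangent of \<open>ln\<close> at \<open>exp 2\<close>, with \<open>36 / 5\<close> as
  a lower bound for \<open>exp 2\<close>. That bound is the eighth power of \<open>41 / 32\<close>,
  the quadratic Taylor value of \<open>exp (1 / 4)\<close>, rounded down.\<close>

lemma ln_le_linear:
  assumes "x > 0"
  shows "ln x \<le> 5 / 36 * x + (1::real)"
proof -
  have "(41 / 32 :: real) \<le> exp (1 / 4)"
    using exp_lower_Taylor_quadratic[of "1 / 4 :: real"] by (simp add: power2_eq_square)
  then have "(41 / 32 :: real) ^ 8 \<le> exp (1 / 4) ^ 8" by (intro power_mono) auto
  also have "\<dots> = exp (2 :: real)" by (simp add: exp_of_nat_mult[symmetric])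
  finally have e2: "36 / 5 \<le> exp (2 :: real)" by (simp add: power_divide)
  have "ln x = ln (x / exp 2) + 2" using assms by (simp add: ln_div)
  also have "ln (x / exp 2) \<le> x / exp 2 - 1" using assms by (intro ln_le_minus_one) simp
  also have "x / exp 2 \<le> x / (36 / 5)" using assms e2 by (intro divide_left_mono) auto
  finally show ?thesis by simp
qed

text \<open>The logarithm of \<open>n ^ (n - k)\<close> times the exponential at
  \<open>c = 2\<close>. The target \<open>2 ^ (n + 1)\<close> absorbs all binomial coefficients at
  once and leaves \<open>1 / 2\<close>.\<close>

lemma far_exponent_le:
  assumes n: "n \<ge> 11" and k: "1 \<le> k" "k < n" "\<not> 3 * (n - k) < n"
  shows "real (n - k) * ln (real n) - real n * (ln (real n) + 2) * (1 - rate n k) \<le> - (real (n + 1) * ln 2)"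
proof -
  define L where "L = ln (real n)"
  have L: "L \<ge> 0" "L \<le> 5 / 36 * real n + 1" using n ln_le_linear[of "real n"] by (simp_all add: L_def)
  have k23: "3 * real k \<le> 2 * real n" using k by linarith
  have n11: "real n \<ge> 11" using n by simp
  have "real n * rate n k * (L + 2) \<le> (4 / 9 * real k + 11 / 6) * (L + 2)"
    using rate_far_le[OF n k(2,3)] L by (intro mult_right_mono) auto
  then have "real (n - k) * L - real n * (L + 2) * (1 - rate n k)
      \<le> (4 / 9 * real k + 11 / 6) * (L + 2) - real k * L - 2 * real n"
    using k by (simp add: of_nat_diff algebra_simps)
  also have "\<dots> = - (5 / 9) * (real k * L) + 8 / 9 * real k + 11 / 6 * L + 11 / 3 - 2 * real n"
    by (simp add: field_simps)
  also have "\<dots> \<le> - (5 / 9) * L + 16 / 27 * real n + 11 / 6 * L + 11 / 3 - 2 * real n"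
  proof -
    have "1 * L \<le> real k * L" using k L by (intro mult_right_mono) auto
    then show ?thesis using k23 by linarith
  qed
  \<comment> \<open>With \<open>L\<close> at its upper bound this becomes
    \<open>3654 \<le> 347 * n\<close>, which holds at 11 but not at 10; \<open>25 / 36\<close> is an
    upper bound for \<open>ln 2\<close>.\<close>
  also have "\<dots> \<le> - (25 / 36) * (real n + 1)"
  proof -
    have "- (5 / 9) * y + 16 / 27 * x + 11 / 6 * y + 11 / 3 - 2 * x \<le> - (25 / 36) * (x + 1)"
      if "y \<le> 5 / 36 * x + 1" "x \<ge> 11" for x y :: real
      using that by (simp add: field_simps)
    then show ?thesis using L n11 by blast
  qed
  also have "\<dots> \<le> - (real (n + 1) * ln 2)"
  proof -
    have "real (n + 1) * ln 2 \<le> real (n + 1) * (25 / 36)"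
      by (rule mult_left_mono[OF ln2_le_25_over_36]) simp
    then show ?thesis by (simp add: algebra_simps)
  qed
  finally show ?thesis by (simp add: L_def)
qed

section \<open>Summation over the levels\<close>

lemma multiplicity_le: "k \<le> n \<Longrightarrow> (fact n / fact k :: real) \<le> real n ^ (n - k)"
proof -
  assume k: "k \<le> n"
  have "fact n div fact k \<le> n ^ (n - k)" using fact_div_fact_le_pow[of "n - k" n] k by simp
  then have "real (fact n div fact k) \<le> real (n ^ (n - k))" by (rule of_nat_mono)
  moreover have "real (fact n div fact k) = fact n / fact k"
    by (simp only: real_of_nat_div[OF fact_dvd[OF k]] of_nat_fact)
  ultimately show ?thesis by simp
qed

text \<open>The two summands on the right belong to the two ranges of \<open>rate\<close>. For small
  \<open>j = n - k\<close> the powers \<open>n ^ j\<close> bounding the binomial coefficient and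
  \<open>n! / k!\<close> cancel against the exponential at \<open>c = 2\<close>, leaving
  \<open>exp (- 4 * j)\<close>. Otherwise the binomial coefficient is kept for the
  summation.\<close>

lemma expansion_term_le:
  assumes n: "n \<ge> 11" and c: "c \<ge> 2" and k: "1 \<le> k" "k < n"
  shows "real (n choose k) * (fact n / fact k) * exp (- (real n * (ln (real n) + c)) * (1 - rate n k))
    \<le> ((1 / 4) ^ (n - k) + real (n choose k) / 2 ^ (n + 1)) * exp (- 2 * (c - 2))"
proof -
  define L where "L = ln (real n)"
  define j where "j = n - k"
  have n0: "real n > 0" using n by simp
  have expL: "exp (real i * L) = real n ^ i" for i
    using n0 by (simp add: L_def exp_of_nat_mult)
  have ex: "exp (- (real n * (L + c)) * (1 - rate n k))
    \<le> exp (- (real n * (L + 2)) * (1 - rate n k)) * exp (- 2 * (c - 2))"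
  proof -
    have "2 * (c - 2) \<le> (real n - real n * rate n k) * (c - 2)"
      using rate_le[OF n k(2)] c by (intro mult_right_mono) auto
    then show ?thesis by (simp add: exp_add[symmetric] algebra_simps)
  qed
  have main: "real (n choose k) * (fact n / fact k) * exp (- (real n * (L + 2)) * (1 - rate n k))
    \<le> (1 / 4) ^ j + real (n choose k) / 2 ^ (n + 1)"
  proof (cases "3 * j < n")
    case True
    have "real n * rate n k = real n - 2 * real j"
      using True n0 by (simp add: rate_def j_def field_simps)
    moreover have "- (real n * (L + 2)) * (1 - rate n k) = - (real n - real n * rate n k) * (L + 2)"
      by (simp add: algebra_simps)
    ultimately have "- (real n * (L + 2)) * (1 - rate n k) = - (2 * real j) * (L + 2)" by simp
    also have "\<dots> = - (real (2 * j) * L) - real j * 4" by (simp add: algebra_simps)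
    finally have "- (real n * (L + 2)) * (1 - rate n k) = - (real (2 * j) * L) - real j * 4" .
    then have "exp (- (real n * (L + 2)) * (1 - rate n k)) = exp (- (real (2 * j) * L)) * exp (- (real j * 4))"
      by (simp add: exp_add[symmetric])
    also have "exp (- (real (2 * j) * L)) = 1 / (real n ^ j * real n ^ j)"
      unfolding exp_minus expL by (simp add: power_add[symmetric] mult_2 inverse_eq_divide)
    also have "exp (- (real j * 4)) \<le> (1 / 4) ^ j"
    proof -
      have "4 \<le> exp (4::real)" using exp_ge_add_one_self[of 4] by simp
      then have "exp (- 4) \<le> (1 / 4 :: real)" by (simp add: exp_minus field_simps)
      then have "exp (- 4) ^ j \<le> (1 / 4 :: real) ^ j" by (intro power_mono) auto
      then show ?thesis by (simp add: exp_of_nat_mult[symmetric])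
    qed
    finally have "exp (- (real n * (L + 2)) * (1 - rate n k)) \<le> 1 / (real n ^ j * real n ^ j) * (1 / 4) ^ j"
      using n0 by (simp add: mult_left_mono divide_right_mono)
    moreover have "real (n choose k) \<le> real n ^ j"
      using binomial_le_pow[of j n] binomial_symmetric[of k n] k by (simp add: j_def flip: of_nat_power)
    moreover have "(fact n / fact k :: real) \<le> real n ^ j" using multiplicity_le[of k n] k by (simp add: j_def)
    ultimately have "real (n choose k) * (fact n / fact k) * exp (- (real n * (L + 2)) * (1 - rate n k))
        \<le> real n ^ j * real n ^ j * (1 / (real n ^ j * real n ^ j) * (1 / 4) ^ j)"
      by (intro mult_mono) auto
    also have "\<dots> = (1 / 4) ^ j" using n0 by simp
    finally show ?thesis by (simp add: add_increasing2)
  next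
    case False
    have "(fact n / fact k :: real) * exp (- (real n * (L + 2)) * (1 - rate n k))
      \<le> real n ^ j * exp (- (real n * (L + 2)) * (1 - rate n k))"
      using multiplicity_le[of k n] k by (intro mult_right_mono) (auto simp: j_def)
    also have "\<dots> = exp (real j * L - real n * (L + 2) * (1 - rate n k))"
      by (simp add: expL[symmetric] exp_add[symmetric])
    also have "\<dots> \<le> exp (- (real (n + 1) * ln 2))"
      using far_exponent_le[OF n k] False by (simp only: exp_le_cancel_iff j_def L_def not_False_eq_True simp_thms)
    also have "\<dots> = 1 / 2 ^ (n + 1)"
      unfolding exp_minus exp_of_nat_mult by (simp add: inverse_eq_divide)
    finally have "real (n choose k) * ((fact n / fact k :: real) * exp (- (real n * (L + 2)) * (1 - rate n k)))
      \<le> real (n choose k) * (1 / 2 ^ (n + 1))" by (rule mult_left_mono) simp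
    then have "real (n choose k) * (fact n / fact k) * exp (- (real n * (L + 2)) * (1 - rate n k))
      \<le> real (n choose k) / 2 ^ (n + 1)" by (simp add: mult.assoc)
    then show ?thesis by (simp add: add_increasing)
  qed
  have "real (n choose k) * (fact n / fact k) * exp (- (real n * (L + c)) * (1 - rate n k))
      \<le> real (n choose k) * (fact n / fact k) * (exp (- (real n * (L + 2)) * (1 - rate n k)) * exp (- 2 * (c - 2)))"
    by (rule mult_left_mono[OF ex]) simp
  also have "\<dots> \<le> ((1 / 4) ^ j + real (n choose k) / 2 ^ (n + 1)) * exp (- 2 * (c - 2))"
    using mult_right_mono[OF main, of "exp (- 2 * (c - 2))"] by (simp only: mult.assoc exp_ge_zero)
  finally show ?thesis by (simp add: L_def j_def)
qed

lemma expansion_sum_le: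
  assumes n: "n \<ge> 11" and c: "c \<ge> 2"
  shows "(\<Sum>k\<in>{1..<n}. real (n choose k) * (fact n / fact k) * exp (- (real n * (ln (real n) + c)) * (1 - rate n k)))
    \<le> exp (- 2 * (c - 2))"
proof -
  have "(\<Sum>k\<in>{1..<n}. real (n choose k) * (fact n / fact k) * exp (- (real n * (ln (real n) + c)) * (1 - rate n k)))
     \<le> (\<Sum>k\<in>{1..<n}. ((1 / 4) ^ (n - k) + real (n choose k) / 2 ^ (n + 1)) * exp (- 2 * (c - 2)))"
    using expansion_term_le[OF n c] by (intro sum_mono) auto
  also have "\<dots> = ((\<Sum>k\<in>{1..<n}. (1 / 4) ^ (n - k)) + (\<Sum>k\<in>{1..<n}. real (n choose k)) / 2 ^ (n + 1)) * exp (- 2 * (c - 2))"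
    by (simp add: sum.distrib sum_distrib_right[symmetric] sum_divide_distrib)
  also have "\<dots> \<le> 1 * exp (- 2 * (c - 2))"
  proof (rule mult_right_mono)
    have "(\<Sum>k\<in>{1..<n}. (1 / 4 :: real) ^ (n - k)) = (\<Sum>i\<in>{1..<n}. (1 / 4) ^ i)"
      by (rule sum.reindex_bij_witness[where i = "\<lambda>i. n - i" and j = "\<lambda>i. n - i"]) auto
    \<comment> \<open>The added term is the tail of the geometric series; with it the value is
      exactly \<open>1 / 3\<close>, independently of \<open>n\<close>, and induction
      applies.\<close>
    also have "\<dots> \<le> (\<Sum>i\<in>{1..<n}. (1 / 4) ^ i) + (1 / 4) ^ n * (4 / 3)" by simp
    also have "(\<Sum>i\<in>{1..<n}. (1 / 4 :: real) ^ i) + (1 / 4) ^ n * (4 / 3) = 1 / 3"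
    proof -
      have "(\<Sum>i\<in>{1..<Suc m}. (1 / 4 :: real) ^ i) + (1 / 4) ^ Suc m * (4 / 3) = 1 / 3" for m
        by (induction m) (auto simp: field_simps)
      from this[of "n - 1"] show ?thesis using n by simp
    qed
    finally have "(\<Sum>k\<in>{1..<n}. (1 / 4 :: real) ^ (n - k)) \<le> 1 / 3" .
    moreover have "(\<Sum>k\<in>{1..<n}. real (n choose k)) \<le> 2 ^ n"
    proof -
      have "(\<Sum>k\<in>{1..<n}. real (n choose k)) \<le> (\<Sum>k\<le>n. real (n choose k))"
        by (intro sum_mono2) auto
      also have "\<dots> = real (2 ^ n)" unfolding choose_row_sum[symmetric] by (rule of_nat_sum[symmetric])
      finally show ?thesis by simp
    qed
    then have "(\<Sum>k\<in>{1..<n}. real (n choose k)) / 2 ^ (n + 1) \<le> 1 / 2" by (simp add: field_simps)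
    ultimately show "(\<Sum>k\<in>{1..<n}. (1 / 4) ^ (n - k)) + (\<Sum>k\<in>{1..<n}. real (n choose k)) / 2 ^ (n + 1) \<le> 1"
      by linarith
  qed simp
  finally show ?thesis by simp
qed

theorem theorem5p7:
  fixes n :: nat and c t :: real
  assumes "n \<ge> 11" and "c \<ge> 2" and "t \<ge> real n / 2 * (ln (real n) + c)"
  shows "d2 n (heat_c4 n t) (unif n) \<le> exp (- (c - 2))"
proof -
  define N where "N = real n * (real n - 1) * (real n - 2) * (real n - 3)"
  have n1: "n \<ge> 1" and n4: "n \<ge> 4" using assms(1) by auto
  show ?thesis
  proof (rule adapted_eigenbasis[OF n1])
    fix E \<theta>
    assume E: "finite E" "orthonormal (Sym n) E"
      "\<And>e. e \<in> E \<Longrightarrow> cyc4_sum {1..n} e = (\<lambda>x. \<theta> e * e x)"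
      "\<And>f. (\<And>x. x \<notin> Sym n \<Longrightarrow> f x = 0) \<Longrightarrow> ip (Sym n) f f = (\<Sum>e\<in>E. (ip (Sym n) f e)\<^sup>2)"
      "\<And>e k f. e \<in> E \<Longrightarrow> e \<notin> no_inv n {1..n} k \<Longrightarrow> f \<in> no_inv n {1..n} k \<Longrightarrow> ip (Sym n) e f = 0"
    define E' where "E' = {e \<in> E. e \<in> no_inv n {1..n} n}"
    \<comment> \<open>Stated with \<open>Suc l\<close>, so that \<open>level e\<close> is the
      \<open>k\<close> for which \<open>e\<close> lies in the space of index \<open>k + 1\<close>
      but not in that of index \<open>k\<close>.\<close>
    define level where "level e = (LEAST l. e \<in> no_inv n {1..n} (Suc l))" for e
    have fE': "finite E'" using E(1) by (simp add: E'_def)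
    have level: "e \<in> no_inv n {1..n} (Suc (level e))" "e \<notin> no_inv n {1..n} (level e)" "1 \<le> level e" "level e < n"
      if e: "e \<in> E'" for e
    proof -
      have en: "e \<in> no_inv n {1..n} (Suc (n - 1))" using e n1 by (simp add: E'_def)
      show 1: "e \<in> no_inv n {1..n} (Suc (level e))" unfolding level_def by (rule LeastI[where P = "\<lambda>l. e \<in> no_inv n {1..n} (Suc l)", OF en])
      have "level e \<le> n - 1" unfolding level_def by (rule Least_le[where P = "\<lambda>l. e \<in> no_inv n {1..n} (Suc l)", OF en])
      then show "level e < n" using n1 by linarith
      have "e \<noteq> (\<lambda>_. 0)"
      proof
        assume "e = (\<lambda>_. 0)"
        then have "ip (Sym n) e e = 0" by (simp add: ip_def)
        then show False using E(2) e by (simp add: orthonormal_def E'_def)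
      qed
      then have ne: "e \<notin> no_inv n {1..n} (Suc 0)" using no_inv_one[of e n "{1..n}"] n1 by auto
      show l1: "1 \<le> level e"
      proof (rule ccontr)
        assume "\<not> 1 \<le> level e"
        then have "level e = 0" by simp
        then show False using 1 ne by simp
      qed
      show "e \<notin> no_inv n {1..n} (level e)"
      proof
        assume "e \<in> no_inv n {1..n} (level e)"
        then have "e \<in> no_inv n {1..n} (Suc (level e - 1))" using l1 by simp
        then have "level e \<le> level e - 1"
          unfolding level_def by (rule Least_le[where P = "\<lambda>l. e \<in> no_inv n {1..n} (Suc l)"])
        then show False using l1 by linarith
      qed
    qed
    have "n > 0" using n1 by simp
    \<comment> \<open>Replacing \<open>t\<close> by its lower bound and the eigenvalue by
      \<open>rate\<close> at the same time uses that \<open>1 - rate\<close> is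
      non-negative.\<close>
    have term_le: "exp (- 2 * t * (1 - \<theta> e / N)) \<le> exp (- (real n * (ln (real n) + c)) * (1 - rate n (level e)))"
      if e: "e \<in> E'" for e
    proof -
      have "\<theta> e / N \<le> rate n (level e)"
        unfolding N_def
        by (rule eigenvalue_le_rate[OF assms(1) level(3,4,1,2)[OF e] E(3)]) (use e in \<open>simp add: E'_def\<close>)
      moreover have "rate n (level e) \<le> 1"
      proof -
        have "real n * rate n (level e) \<le> real n * 1" using rate_le[OF assms(1) level(4)[OF e]] by simp
        then show ?thesis using \<open>n > 0\<close> by (simp only: mult_le_cancel_left_pos of_nat_0_less_iff)
      qed
      moreover have "0 \<le> ln (real n)" using n1 by simp
      ultimately have "real n * (ln (real n) + c) * (1 - rate n (level e)) \<le> 2 * t * (1 - \<theta> e / N)"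
      proof (intro mult_mono[of _ "2 * t"])
        have "0 \<le> real n * (ln (real n) + c)" using assms(2) \<open>0 \<le> ln (real n)\<close> by simp
        then show "0 \<le> 2 * t" using assms(3) by simp
      qed (use assms(3) in auto)
      then show ?thesis by simp
    qed
    \<comment> \<open>Basis vectors of level \<open>k\<close> lie outside
      \<open>no_inv n {1..n} k\<close>; since the basis is adapted, they are perpendicular to that
      space, hence spanned by the coset indicators.\<close>
    have count: "real (card {e \<in> E'. level e = k}) \<le> real (n choose k) * (fact n / fact k)" for k
    proof -
      have "card {e \<in> E'. level e = k} \<le> card (coset_indicators n {1..n} k)"
      proof (rule orthonormal_perp_card_le[OF finite_Sym])
        show "finite (coset_indicators n {1..n} k)" by (rule finite_coset_indicators) simp
        show "finite {e \<in> E'. level e = k}" using fE' by simp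
        show "orthonormal (Sym n) {e \<in> E'. level e = k}"
          using E(2) by (auto simp: orthonormal_def E'_def)
        fix e f assume e: "e \<in> {e \<in> E'. level e = k}" and f: "f \<in> annihilator (Sym n) (coset_indicators n {1..n} k)"
        then have "f \<in> no_inv n {1..n} k" by (simp add: no_inv_eq_annihilator)
        then show "ip (Sym n) e f = 0"
          using e level(2)[of e] by (intro E(5)[of e k f]) (auto simp: E'_def)
      qed
      then show ?thesis using card_coset_indicators_le[of n k] by linarith
    qed
    have "(d2 n (heat_c4 n t) (unif n))\<^sup>2 = (\<Sum>e\<in>E'. exp (- 2 * t * (1 - \<theta> e / N)))"
      unfolding E'_def N_def by (rule d2_heat_sq[OF n4 E])
    also have "\<dots> \<le> (\<Sum>e\<in>E'. exp (- (real n * (ln (real n) + c)) * (1 - rate n (level e))))"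
      by (intro sum_mono term_le)
    also have "\<dots> = (\<Sum>k\<in>{1..<n}. \<Sum>e\<in>{e \<in> E'. level e = k}. exp (- (real n * (ln (real n) + c)) * (1 - rate n (level e))))"
      using fE' level(3,4) by (intro sum.group[symmetric]) auto
    also have "\<dots> = (\<Sum>k\<in>{1..<n}. real (card {e \<in> E'. level e = k}) * exp (- (real n * (ln (real n) + c)) * (1 - rate n k)))"
      by (intro sum.cong refl) simp
    also have "\<dots> \<le> (\<Sum>k\<in>{1..<n}. real (n choose k) * (fact n / fact k) * exp (- (real n * (ln (real n) + c)) * (1 - rate n k)))"
      by (intro sum_mono mult_right_mono count) simp
    also have "\<dots> \<le> exp (- 2 * (c - 2))" by (rule expansion_sum_le[OF assms(1,2)])
    also have "\<dots> = (exp (- (c - 2)))\<^sup>2" by (simp add: exp_double[symmetric])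
    finally show ?thesis by (rule power2_le_imp_le) simp
  qed
qed

end
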